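(* There exists an absolute constant $\gamma>0$ with the following property. For every $0<\delta\le1$, any positive integer $N$, any $(\delta,N)$-focused pair of homogeneous polynomials $f,g:\mathbb{R}^n\to\mathbb{R}$ of degree $m$, any $\epsilon>0$, and any positive integer $k\le n$ with $k\ge\gamma\,\epsilon^{-2}\delta^{-2}\ln(N+2)$, the inequality $$(1-\epsilon)^m\langle f_L,g_L\rangle\le\left(\frac{k}{n}\right)^m\langle f,g\rangle\le(1-\epsilon)^{-m}\langle f_L,g_L\rangle$$ holds with probability at least $2/3$ for a random $k$-dimensional subspace $L\subset\mathbb{R}^n$, chosen according to the Haar probability measure on the Grassmannian $G_k(\mathbb{R}^n)$.
   Context: Identify $\mathbb{R}^n\oplus\mathbb{R}^n=\mathbb{C}^n$ via $z=x+iy$; real polynomials on $\mathbb{R}^n$ are extended to $\mathbb{C}^n$ as polynomials with the same coefficients. Let $\nu_n$ be the Gaussian measure on $\mathbb{C}^n$ with density $\pi^{-n}e^{-\|z\|^2}$, $\|z\|^2=\|x\|^2+\|y\|^2$. For polynomials $f,g$ set $\langle f,g\rangle=\int_{\mathbb{C}^n}f(z)\overline{g(z)}\,d\nu_n$. For a $k$-dimensional subspace $L\subset\mathbb{R}^n$, let $L_{\mathbb{C}}=L\oplus iL\subset\mathbb{C}^n$, let $\nu_k$ be the Gaussian measure on $L_{\mathbb{C}}$ with density $\pi^{-k}e^{-\|z\|^2}$, let $f_L,g_L$ be the restrictions of $f,g$ to $L$, and set $\langle f_L,g_L\rangle=\int_{L_{\mathbb{C}}}f(z)\overline{g(z)}\,d\nu_k$.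 Definition: for $0<\delta\le1$ and a positive integer $N$, a pair of homogeneous polynomials $f,g:\mathbb{R}^n\to\mathbb{R}$ of degree $m$ is $(\delta,N)$-focused if there exist nonzero vectors $a_1,\dots,a_N\in\mathbb{R}^n$ and nonzero vectors $b_1,\dots,b_N\in\mathbb{R}^n$ such that for every pair $(i,j)$ the cosine of the angle between $a_i$ and $b_j$ is at least $\delta$, and $f(x)=\sum_I\alpha_I\prod_{i\in I}\langle a_i,x\rangle$, $g(x)=\sum_J\beta_J\prod_{j\in J}\langle b_j,x\rangle$, where the sums are over subsets $I,J\subset\{1,\dots,N\}$ with $|I|=|J|=m$ and all $\alpha_I,\beta_J\ge0$. Here $\langle x,y\rangle$ on vectors is the standard scalar product of $\mathbb{R}^n$.
   Formalization: The formal theorem requires 0<ε<1 instead of any ε>0: at ε=1 the factor (1-ε)^{-m} is undefined, and for ε=2, m=1, f=g=x_1, k=n large the inequality would read 1 ≤ -1. *)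

theory Defs
  imports "HOL-Probability.Probability"
begin

text \<open>Vectors of R^n are functions nat => real, only coordinates l < n matter.
  Vectors of C^n = R^n + iR^n are functions nat => complex.\<close>

definition rdot :: "nat \<Rightarrow> (nat \<Rightarrow> real) \<Rightarrow> (nat \<Rightarrow> real) \<Rightarrow> real" where
  "rdot n a x = (\<Sum>l<n. a l * x l)"

definition rnorm :: "nat \<Rightarrow> (nat \<Rightarrow> real) \<Rightarrow> real" where
  "rnorm n a = sqrt (rdot n a a)"

definition msubsets :: "nat \<Rightarrow> nat \<Rightarrow> nat set set" where
  "msubsets N m = {I. I \<subseteq> {..<N} \<and> card I = m}"

definition cpoly :: "nat \<Rightarrow> nat \<Rightarrow> nat \<Rightarrow> (nat \<Rightarrow> nat \<Rightarrow> real) \<Rightarrow> (nat set \<Rightarrow> real)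
    \<Rightarrow> (nat \<Rightarrow> complex) \<Rightarrow> complex" where
  "cpoly n N m a \<alpha> z =
     (\<Sum>I\<in>msubsets N m. complex_of_real (\<alpha> I) * (\<Prod>i\<in>I. \<Sum>l<n. complex_of_real (a i l) * z l))"

definition rpoly :: "nat \<Rightarrow> nat \<Rightarrow> nat \<Rightarrow> (nat \<Rightarrow> nat \<Rightarrow> real) \<Rightarrow> (nat set \<Rightarrow> real)
    \<Rightarrow> (nat \<Rightarrow> real) \<Rightarrow> real" where
  "rpoly n N m a \<alpha> x = (\<Sum>I\<in>msubsets N m. \<alpha> I * (\<Prod>i\<in>I. rdot n (a i) x))"

text \<open>(delta,N)-focused representation data for the pair f = rpoly n N m a alpha,
  g = rpoly n N m b beta.\<close>
definition focused :: "nat \<Rightarrow> nat \<Rightarrow> nat \<Rightarrow> real \<Rightarrow> (nat \<Rightarrow> nat \<Rightarrow> real) \<Rightarrow> (nat \<Rightarrow> nat \<Rightarrow> real)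
    \<Rightarrow> (nat set \<Rightarrow> real) \<Rightarrow> (nat set \<Rightarrow> real) \<Rightarrow> bool" where
  "focused n N m \<delta> a b \<alpha> \<beta> \<longleftrightarrow>
     (\<forall>i<N. \<exists>l<n. a i l \<noteq> 0) \<and> (\<forall>j<N. \<exists>l<n. b j l \<noteq> 0) \<and>
     (\<forall>i<N. \<forall>j<N. rdot n (a i) (b j) \<ge> \<delta> * rnorm n (a i) * rnorm n (b j)) \<and>
     (\<forall>I\<in>msubsets N m. \<alpha> I \<ge> 0) \<and> (\<forall>J\<in>msubsets N m. \<beta> J \<ge> 0)"

definition cgauss :: "complex measure" where
  "cgauss = density lborel (\<lambda>w. ennreal (exp (- (cmod w)\<^sup>2) / pi))"

definition cgauss_vec :: "nat \<Rightarrow> (nat \<Rightarrow> complex) measure" where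
  "cgauss_vec d = PiM {..<d} (\<lambda>_. cgauss)"

definition gip :: "nat \<Rightarrow> ((nat \<Rightarrow> complex) \<Rightarrow> complex) \<Rightarrow> ((nat \<Rightarrow> complex) \<Rightarrow> complex) \<Rightarrow> complex" where
  "gip d F G = (\<integral>z. F z * cnj (G z) \<partial>cgauss_vec d)"

text \<open>Linear span of vectors X_0..X_{k-1} in R^n (as a set; coordinates >= n unconstrained).\<close>
definition lspan :: "nat \<Rightarrow> nat \<Rightarrow> (nat \<Rightarrow> nat \<Rightarrow> real) \<Rightarrow> (nat \<Rightarrow> real) set" where
  "lspan n k X = {x. \<exists>c. \<forall>l<n. x l = (\<Sum>j<k. c j * X j l)}"

definition is_onb :: "nat \<Rightarrow> nat \<Rightarrow> (nat \<Rightarrow> real) set \<Rightarrow> (nat \<Rightarrow> nat \<Rightarrow> real) \<Rightarrow> bool" where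
  "is_onb n k L u \<longleftrightarrow> (\<forall>i<k. \<forall>j<k. rdot n (u i) (u j) = (if i = j then 1 else 0))
      \<and> L = lspan n k u"

text \<open>Restriction to L_C = L + iL: with an orthonormal basis u of L, the map
  w |-> sum_j w_j u_j is an isometry C^k -> L_C carrying nu_k on C^k to the Gaussian
  measure nu_k on L_C (basis-independent by unitary invariance).\<close>
definition cemb :: "nat \<Rightarrow> (nat \<Rightarrow> nat \<Rightarrow> real) \<Rightarrow> (nat \<Rightarrow> complex) \<Rightarrow> (nat \<Rightarrow> complex)" where
  "cemb k u w = (\<lambda>l. \<Sum>j<k. w j * complex_of_real (u j l))"

definition sub_gip :: "nat \<Rightarrow> nat \<Rightarrow> (nat \<Rightarrow> real) set \<Rightarrow> ((nat \<Rightarrow> complex) \<Rightarrow> complex)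
    \<Rightarrow> ((nat \<Rightarrow> complex) \<Rightarrow> complex) \<Rightarrow> complex" where
  "sub_gip n k L F G = (let u = (SOME u. is_onb n k L u) in
      gip k (\<lambda>w. F (cemb k u w)) (\<lambda>w. G (cemb k u w)))"

text \<open>Haar probability on the Grassmannian G_k(R^n): realised as the law of the span of
  k i.i.d. standard Gaussian vectors in R^n (which is the unique O(n)-invariant
  probability measure on k-dimensional subspaces).\<close>
definition rgauss :: "real measure" where
  "rgauss = density lborel (\<lambda>x. ennreal (exp (- x\<^sup>2 / 2) / sqrt (2 * pi)))"

definition gauss_frames :: "nat \<Rightarrow> nat \<Rightarrow> (nat \<Rightarrow> nat \<Rightarrow> real) measure" where
  "gauss_frames n k = PiM {..<k} (\<lambda>_. PiM {..<n} (\<lambda>_. rgauss))"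

definition grass_prob :: "nat \<Rightarrow> nat \<Rightarrow> ((nat \<Rightarrow> real) set \<Rightarrow> bool) \<Rightarrow> real" where
  "grass_prob n k P = measure (gauss_frames n k) {X \<in> space (gauss_frames n k). P (lspan n k X)}"

end

theory Submission
  imports Defs "HOL-Computational_Algebra.Polynomial"
begin

text \<open>By Wick's formula \<open>\<langle>f, g\<rangle>\<close> is a combination, with the nonnegative weights \<open>\<alpha>\<^sub>I \<beta>\<^sub>J\<close>,
  of permanents of the matrices \<open>(\<langle>a\<^sub>i, b\<^sub>j\<rangle>)\<close>, and \<open>\<langle>f\<^sub>L, g\<^sub>L\<rangle>\<close> is the same combination for the
  matrices of the scalar products of the orthogonal projections to \<open>L\<close>. All entries are positive, so it
  suffices that each scalar product \<open>\<langle>a\<^sub>i, b\<^sub>j\<rangle>\<close> is scaled by \<open>k / n\<close> up to a factor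
  \<open>1 \<plusminus> \<epsilon>\<close>. Since the cosines are at least \<open>\<delta>\<close>, polarization reduces this to the
  Johnson--Lindenstrauss estimate with relative error \<open>\<epsilon> \<delta>\<close> for the \<open>2 N\<^sup>2\<close> vectors
  \<open>a\<^sub>i / \<parallel>a\<^sub>i\<parallel> \<plusminus> b\<^sub>j / \<parallel>b\<^sub>j\<parallel>\<close>. By rotation invariance a fixed vector and a random
  subspace may be replaced by a Gaussian vector and a fixed subspace, where Chernoff bounds for
  \<open>\<chi>\<^sup>2\<close> variables apply.\<close>

text \<open>The event concerns a subspace, but the measure lives on frames, and
  \<open>sub_gip\<close> selects an unknown orthonormal basis. Gram--Schmidt gives a basis depending
  measurably on the frame, and the projected scalar products do not depend on the basis.
  Gram--Schmidt also commutes with rotations. Hence the probability that a nonzero vector is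
  distorted depends neither on its direction nor on its length, so it may be averaged over a
  Gaussian vector, and Fubini then freezes the frame. The rotations used are those of coordinate
  planes: each mixes only two factors of a product measure, and together they carry every nonzero
  vector to the first axis.

  The relative error has to be \<epsilon> * \<delta>: the squared norms of the sum and of the
  difference of two unit vectors add up to 4, while their scalar product may be as small as
  \<delta>.

  The constant is 864 = 6 * 9 * 16. Chi-square tails with d degrees of freedom decay like exp (- d *
  \<eta>^2 / 16), comparing two such variables uses \<eta> / 3 in place of \<eta>, and the factor 6
  leaves (N + 2)^(-6) against the union bound.\<close>

section \<open>Gaussian integration by parts on the complex plane\<close>

lemma borel_measurable_cnj [measurable (raw)]:
  "f \<in> borel_measurable M \<Longrightarrow> (\<lambda>x. cnj (f x)) \<in> borel_measurable M"
  by (rule measurable_compose[OF _ borel_measurable_continuous_onI]) (auto intro: continuous_intros)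

lemma borel_measurable_poly_complex [measurable (raw)]:
  fixes p :: "complex poly"
  shows "f \<in> borel_measurable M \<Longrightarrow> (\<lambda>x. poly p (f x)) \<in> borel_measurable M"
  by (rule measurable_compose[OF _ borel_measurable_continuous_onI]) (auto intro: continuous_intros)

text \<open>Polynomial growth in the form needed for domination: powers of \<open>1 + cmod w\<close>
  increase with the exponent and multiply by adding exponents.\<close>

lemma poly_norm_bound:
  fixes p :: "complex poly"
  shows "\<exists>C\<ge>0. \<exists>d. \<forall>w. cmod (poly p w) \<le> C * (1 + cmod w) ^ d"
proof (induction p)
  case 0
  show ?case by (intro exI[of _ 0]) auto
next
  case (pCons a p)
  then obtain C d where C: "C \<ge> 0" "\<And>w. cmod (poly p w) \<le> C * (1 + cmod w) ^ d" by blast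
  have "cmod (poly (pCons a p) w) \<le> (cmod a + C) * (1 + cmod w) ^ Suc d" for w
  proof -
    have "cmod (poly (pCons a p) w) \<le> cmod a + cmod w * cmod (poly p w)"
      by (simp add: norm_triangle_le norm_mult)
    also have "\<dots> \<le> cmod a * (1 + cmod w) ^ Suc d + (1 + cmod w) * (C * (1 + cmod w) ^ d)"
      using C by (intro add_mono mult_mono mult_left_mono) (auto simp: mult_le_cancel_left1
          simp del: power_Suc intro!: one_le_power)
    also have "\<dots> = (cmod a + C) * (1 + cmod w) ^ Suc d" by (simp add: algebra_simps)
    finally show ?thesis .
  qed
  with C show ?case by (intro exI[of _ "cmod a + C"] conjI exI[of _ "Suc d"]) auto
qed

section \<open>The real Gaussian law of variance 1/2\<close>

definition hgauss :: "real measure" where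
  "hgauss = density lborel (\<lambda>x. ennreal (normal_density 0 (1 / sqrt 2) x))"

lemma hgauss_density: "normal_density 0 (1 / sqrt 2) x = exp (- x\<^sup>2) / sqrt pi"
  by (simp add: normal_density_def power_divide)

lemma sets_hgauss [measurable_cong, simp]: "sets hgauss = sets borel"
  and space_hgauss [simp]: "space hgauss = UNIV"
  by (auto simp: hgauss_def)

lemma prob_space_hgauss: "prob_space hgauss"
  unfolding hgauss_def by (rule prob_space_normal_density) simp

interpretation hgauss: prob_space hgauss
  by (rule prob_space_hgauss)

lemma hgauss_moment:
  shows hgauss_integrable_power: "integrable hgauss (\<lambda>x. x ^ j)"
    and hgauss_integrable_power_abs: "integrable hgauss (\<lambda>x. \<bar>x\<bar> ^ j)"
proof -
  show "integrable hgauss (\<lambda>x. x ^ j)"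
    unfolding hgauss_def
    by (subst integrable_density) (use integrable_normal_moment[of "1/sqrt 2" 0 j] in auto)
  show "integrable hgauss (\<lambda>x. \<bar>x\<bar> ^ j)"
    unfolding hgauss_def
    by (subst integrable_density) (use integrable_normal_moment_abs[of "1/sqrt 2" 0 j] in auto)
qed

lemma hgauss_integral:
  "(\<integral>x. x ^ j \<partial>hgauss) = (\<integral>x. normal_density 0 (1/sqrt 2) x * x ^ j \<partial>lborel)"
  unfolding hgauss_def by (subst integral_density) auto

lemma hgauss_moment_even: "(\<integral>x. x ^ (2 * k) \<partial>hgauss) = fact (2 * k) / (4 ^ k * fact k)"
  and hgauss_moment_odd: "(\<integral>x. x ^ (2 * k + 1) \<partial>hgauss) = 0"
  unfolding hgauss_integral
  using integral_normal_moment_even[of "1/sqrt 2" 0 k] integral_normal_moment_odd[of "1/sqrt 2" 0 k]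
  by (simp_all add: power_divide)

lemma hgauss_moment_rec: "(\<integral>x. x ^ Suc j \<partial>hgauss) = real j / 2 * (\<integral>x. x ^ (j - 1) \<partial>hgauss)"
proof (cases "even j")
  case True
  then obtain k where k: "j = 2 * k" by (elim evenE)
  have "(\<integral>x. x ^ Suc j \<partial>hgauss) = 0" using hgauss_moment_odd[of k] unfolding k by simp
  \<comment> \<open>For \<open>k = 0\<close> the factor \<open>real j\<close> vanishes, so the
    truncated exponent \<open>j - 1\<close> is harmless.\<close>
  moreover have "real j / 2 * (\<integral>x. x ^ (j - 1) \<partial>hgauss) = 0"
    using hgauss_moment_odd[of "k - 1"] by (cases k) (auto simp: k)
  ultimately show ?thesis by simp
next
  case False
  then obtain k where k: "j = 2 * k + 1" by (elim oddE)
  have "(\<integral>x. x ^ Suc j \<partial>hgauss) = fact (2 * Suc k) / (4 ^ Suc k * fact (Suc k))"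
    using hgauss_moment_even[of "Suc k"] unfolding k by simp
  moreover have "(\<integral>x. x ^ (j - 1) \<partial>hgauss) = fact (2 * k) / (4 ^ k * fact k)"
    using hgauss_moment_even[of k] unfolding k by simp
  moreover have "fact (2 * Suc k) / (4 ^ Suc k * fact (Suc k)) =
      (real (2 * k + 1) / 2) * (fact (2 * k) / (4 ^ k * fact k) :: real)"
    by (simp add: divide_simps)
  ultimately show ?thesis by (simp add: k)
qed

lemma hgauss_integrable_poly:
  fixes p :: "complex poly"
  shows "integrable hgauss (\<lambda>x. poly p (of_real x))"
proof -
  have "integrable hgauss (\<lambda>x. complex_of_real (x ^ i))" for i
    using hgauss_integrable_power by (rule integrable_of_real)
  then show ?thesis unfolding poly_altdef by auto
qed

text \<open>Integration by parts; the factor 1/2 is the variance. By linearity it reduces to the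
  moment recursion. The coefficients are complex because the polynomials will be slices of functions
  on the complex plane.\<close>

lemma hgauss_stein:
  fixes p :: "complex poly"
  shows "(\<integral>x. of_real x * poly p (of_real x) \<partial>hgauss) = (\<integral>x. poly (pderiv p) (of_real x) \<partial>hgauss) / 2"
proof -
  have m: "(\<integral>x. of_real x * poly (monom c j) (of_real x) \<partial>hgauss) =
      (\<integral>x. poly (pderiv (monom c j)) (complex_of_real x) \<partial>hgauss) / 2" for c :: complex and j
  proof -
    have "(\<integral>x. of_real x * poly (monom c j) (of_real x) \<partial>hgauss) =
        (\<integral>x. c * complex_of_real (x ^ Suc j) \<partial>hgauss)"
      by (simp add: poly_monom algebra_simps)
    also have "\<dots> = c * complex_of_real (\<integral>x. x ^ Suc j \<partial>hgauss)"
      by (subst integral_mult_right_zero) (simp only: integral_complex_of_real)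
    also have "\<dots> = of_nat j * c * complex_of_real (\<integral>x. x ^ (j - 1) \<partial>hgauss) / 2"
      by (subst hgauss_moment_rec) simp
    also have "of_nat j * c * complex_of_real (\<integral>x. x ^ (j - 1) \<partial>hgauss) =
        (\<integral>x. of_nat j * c * complex_of_real (x ^ (j - 1)) \<partial>hgauss)"
      by (subst integral_mult_right_zero) (simp only: integral_complex_of_real)
    finally show ?thesis by (simp add: poly_monom pderiv_monom)
  qed
  have int: "integrable hgauss (\<lambda>x. of_real x * poly p (of_real x))" for p :: "complex poly"
    using hgauss_integrable_poly[of "pCons 0 p"] by simp
  have fin: "(\<integral>x. of_real x * poly (\<Sum>i\<in>A. monom (coeff p i) i) (of_real x) \<partial>hgauss) =
     (\<integral>x. poly (pderiv (\<Sum>i\<in>A. monom (coeff p i) i)) (of_real x) \<partial>hgauss) / 2" if "finite A" for A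
    using that
  proof induction
    case (insert i A)
    then show ?case
      by (simp add: pderiv_add ring_distribs Bochner_Integration.integral_add[OF int int]
          Bochner_Integration.integral_add[OF hgauss_integrable_poly hgauss_integrable_poly] m
          add_divide_distrib)
  qed simp
  from fin[of "{..degree p}"] show ?thesis by (simp add: poly_as_sum_of_monoms)
qed

section \<open>The complex Gaussian as a product of two real ones\<close>

lemma measurable_Complex [measurable]:
  "(\<lambda>z. Complex (fst z) (snd z)) \<in> borel_measurable (borel \<Otimes>\<^sub>M borel)"
  unfolding Complex_eq by measurable

lemma lborel_complex:
  "(lborel :: complex measure) = distr (lborel \<Otimes>\<^sub>M lborel) borel (\<lambda>z. Complex (fst z) (snd z))"
proof (rule lborel_eqI)
  fix l u :: complex
  assume le: "\<And>b. b \<in> Basis \<Longrightarrow> l \<bullet> b \<le> u \<bullet> b"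
  have le': "Re l \<le> Re u" "Im l \<le> Im u" using le[of 1] le[of \<i>] by (auto simp: Basis_complex_def)
  have "emeasure (distr (lborel \<Otimes>\<^sub>M lborel) borel (\<lambda>z. Complex (fst z) (snd z))) (box l u) =
      emeasure (lborel \<Otimes>\<^sub>M lborel) ({Re l<..<Re u} \<times> {Im l<..<Im u})"
    by (subst emeasure_distr) (auto simp: in_box_complex_iff space_pair_measure
        intro!: arg_cong2[where f=emeasure])
  also have "\<dots> = (\<Prod>b\<in>Basis. (u - l) \<bullet> b)"
    using le' by (subst lborel.emeasure_pair_measure_Times)
      (auto simp: Basis_complex_def ennreal_mult[symmetric])
  finally show "emeasure (distr (lborel \<Otimes>\<^sub>M lborel) borel (\<lambda>z. Complex (fst z) (snd z))) (box l u) =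
      (\<Prod>b\<in>Basis. (u - l) \<bullet> b)" .
qed simp

lemma sets_cgauss [measurable_cong, simp]: "sets cgauss = sets borel"
  and space_cgauss [simp]: "space cgauss = UNIV"
  by (auto simp: cgauss_def)

lemma cgauss_eq_distr:
  "cgauss = distr (hgauss \<Otimes>\<^sub>M hgauss) borel (\<lambda>z. Complex (fst z) (snd z))"
proof -
  have "hgauss \<Otimes>\<^sub>M hgauss = density (lborel \<Otimes>\<^sub>M lborel)
      (\<lambda>(x, y). ennreal (normal_density 0 (1 / sqrt 2) x) * ennreal (normal_density 0 (1 / sqrt 2) y))"
    unfolding hgauss_def
    by (rule pair_measure_density) (auto intro: hgauss.sigma_finite_measure_axioms[unfolded hgauss_def]
        lborel.sigma_finite_measure_axioms)
  also have "\<dots> = density (lborel \<Otimes>\<^sub>M lborel)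
      ((\<lambda>w. ennreal (exp (- (cmod w)\<^sup>2) / pi)) \<circ> (\<lambda>z. Complex (fst z) (snd z)))"
    by (intro density_cong) (auto simp: hgauss_density ennreal_mult[symmetric] cmod_power2
       mult_exp_exp algebra_simps intro!: AE_I2)
  finally show ?thesis
    unfolding cgauss_def
    by (subst lborel_complex, subst density_distr) (auto simp: comp_def)
qed

lemma prob_space_cgauss: "prob_space cgauss"
proof -
  interpret pair_prob_space hgauss hgauss ..
  show ?thesis unfolding cgauss_eq_distr by (rule prob_space_distr) measurable
qed

interpretation cgauss: prob_space cgauss
  by (rule prob_space_cgauss)

lemma hgauss_integrable_weight: "integrable hgauss (\<lambda>x. (1 + \<bar>x\<bar>) ^ d)"
proof -
  have "integrable hgauss (\<lambda>x. \<Sum>i\<le>d. real (d choose i) * \<bar>x\<bar> ^ i)"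
    by (intro Bochner_Integration.integrable_sum integrable_mult_right hgauss_integrable_power_abs)
  moreover have "(1 + \<bar>x\<bar>) ^ d = (\<Sum>i\<le>d. real (d choose i) * \<bar>x\<bar> ^ i)" for x :: real
    using binomial_ring[of "\<bar>x\<bar>" 1 d] by (simp add: add.commute)
  ultimately show ?thesis by simp
qed

lemma integrable_pair_mult:
  fixes f g :: "real \<Rightarrow> real"
  assumes "integrable hgauss f" "integrable hgauss g"
  shows "integrable (hgauss \<Otimes>\<^sub>M hgauss) (\<lambda>z. f (fst z) * g (snd z))"
proof -
  interpret pair_prob_space hgauss hgauss ..
  have [measurable]: "f \<in> borel_measurable borel" "g \<in> borel_measurable borel"
    using assms[THEN borel_measurable_integrable] by simp_all
  show ?thesis
    by (rule Fubini_integrable) (use assms in \<open>auto simp: abs_mult\<close>)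
qed

lemma cgauss_integrable_weight: "integrable cgauss (\<lambda>w. (1 + cmod w) ^ d)"
proof -
  have "integrable (hgauss \<Otimes>\<^sub>M hgauss) (\<lambda>z. (1 + \<bar>fst z\<bar>) ^ d * (1 + \<bar>snd z\<bar>) ^ d)"
    by (intro integrable_pair_mult hgauss_integrable_weight)
  then have "integrable (hgauss \<Otimes>\<^sub>M hgauss) (\<lambda>z. (1 + cmod (Complex (fst z) (snd z))) ^ d)"
  proof (rule Bochner_Integration.integrable_bound)
    \<comment> \<open>Since the modulus is at most the sum of the absolute values of the two parts,
      the weight is dominated by a product of one-variable weights, each with finite
      moments.\<close>
    have "(1 + cmod (Complex x y)) ^ d \<le> (1 + \<bar>x\<bar>) ^ d * (1 + \<bar>y\<bar>) ^ d" for x y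
    proof -
      have "1 + cmod (Complex x y) \<le> (1 + \<bar>x\<bar>) * (1 + \<bar>y\<bar>)"
        using cmod_le[of "Complex x y"] by (simp add: algebra_simps) (smt (verit) mult_nonneg_nonneg)
      then show ?thesis by (metis power_mono power_mult_distrib add_nonneg_nonneg norm_ge_zero zero_le_one)
    qed
    then show "AE z in hgauss \<Otimes>\<^sub>M hgauss. norm ((1 + cmod (Complex (fst z) (snd z))) ^ d)
        \<le> norm ((1 + \<bar>fst z\<bar>) ^ d * (1 + \<bar>snd z\<bar>) ^ d)"
      by (auto intro!: AE_I2 simp: abs_mult)
  qed measurable
  then show ?thesis unfolding cgauss_eq_distr by (subst integrable_distr_eq) auto
qed

lemma cgauss_integrable_poly:
  fixes p q :: "complex poly"
  shows "integrable cgauss (\<lambda>w. poly p w * cnj (poly q w))"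
proof -
  obtain C d where C: "C \<ge> 0" "\<And>w. cmod (poly p w) \<le> C * (1 + cmod w) ^ d"
    using poly_norm_bound by blast
  obtain D e where D: "D \<ge> 0" "\<And>w. cmod (poly q w) \<le> D * (1 + cmod w) ^ e"
    using poly_norm_bound by blast
  have "integrable cgauss (\<lambda>w. C * D * (1 + cmod w) ^ (d + e))"
    by (intro integrable_mult_right cgauss_integrable_weight)
  then show ?thesis
  proof (rule Bochner_Integration.integrable_bound)
    have "cmod (poly p w * cnj (poly q w)) \<le> C * D * (1 + cmod w) ^ (d + e)" for w
    proof -
      have "cmod (poly p w * cnj (poly q w)) \<le> (C * (1 + cmod w) ^ d) * (D * (1 + cmod w) ^ e)"
        unfolding norm_mult complex_mod_cnj using C D by (intro mult_mono) auto
      then show ?thesis by (simp add: power_add algebra_simps)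
    qed
    then show "AE w in cgauss. norm (poly p w * cnj (poly q w)) \<le> norm (C * D * (1 + cmod w) ^ (d + e))"
      by (intro AE_I2) (metis abs_ge_self order_trans real_norm_def)
  qed measurable
qed


text \<open>Along a horizontal or vertical line \<open>cnj w\<close> is affine in the real
  parameter, so this makes the conjugated factor a polynomial in that parameter.\<close>

lemma cnj_poly: "cnj (poly q w) = poly (map_poly cnj q) (cnj w)"
  by (simp add: poly_altdef degree_map_poly coeff_map_poly)

lemma pderiv_map_poly_cnj: "pderiv (map_poly cnj q) = map_poly cnj (pderiv q)"
  by (intro poly_eqI) (simp add: coeff_pderiv coeff_map_poly)

text \<open>Writing w = x + i y, apply \<open>hgauss_stein\<close> in each real variable. The
  operator d/dx + i d/dy annihilates the holomorphic factor \<open>p\<close> and doubles the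
  derivative of the antiholomorphic factor; the 2 cancels the variance 1/2.\<close>

lemma cgauss_stein:
  fixes p q :: "complex poly"
  shows "(\<integral>w. w * (poly p w * cnj (poly q w)) \<partial>cgauss) =
    (\<integral>w. poly p w * cnj (poly (pderiv q) w) \<partial>cgauss)"
proof -
  interpret P: pair_prob_space hgauss hgauss ..
  define c where "c = (\<lambda>z. Complex (fst z) (snd z))"
  define PQ where "PQ = (\<lambda>p q w. poly p w * cnj (poly q w))"
  have c [measurable]: "c \<in> borel_measurable (hgauss \<Otimes>\<^sub>M hgauss)"
    unfolding c_def by measurable
  have PQm [measurable]: "PQ p q \<in> borel_measurable borel" for p q
    unfolding PQ_def by measurable
  have int: "integrable (hgauss \<Otimes>\<^sub>M hgauss) (\<lambda>z. PQ p q (c z))" for p q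
    using cgauss_integrable_poly[of p q] unfolding cgauss_eq_distr PQ_def c_def
    by (subst (asm) integrable_distr_eq) auto
  have cg: "(\<integral>w. f w \<partial>cgauss) = (\<integral>z. f (c z) \<partial>(hgauss \<Otimes>\<^sub>M hgauss))"
    if "f \<in> borel_measurable borel" for f :: "complex \<Rightarrow> complex"
    unfolding cgauss_eq_distr c_def by (subst integral_distr) (use that in auto)
  \<comment> \<open>Multiplication by \<open>w\<close> or \<open>cnj w\<close> stays within the
    functions \<open>PQ p q\<close>, so the weights \<open>fst z\<close> and \<open>snd z\<close>
    inherit integrability from the polynomial case.\<close>
  have pQ: "PQ (pCons 0 p) q w = w * PQ p q w" "PQ p (pCons 0 q) w = cnj w * PQ p q w" for p q w
    by (simp_all add: PQ_def)
  have re: "complex_of_real (fst z) * PQ p q (c z) = (PQ (pCons 0 p) q (c z) + PQ p (pCons 0 q) (c z)) / 2"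
    and im: "complex_of_real (snd z) * PQ p q (c z) = (PQ (pCons 0 p) q (c z) - PQ p (pCons 0 q) (c z)) / (2 * \<i>)" for p q z
    by (simp_all add: pQ c_def Complex_eq field_simps)
  have intx: "integrable (hgauss \<Otimes>\<^sub>M hgauss) (\<lambda>z. complex_of_real (fst z) * PQ p q (c z))"
    unfolding re by (intro integrable_divide Bochner_Integration.integrable_add int)
  have inty: "integrable (hgauss \<Otimes>\<^sub>M hgauss) (\<lambda>z. complex_of_real (snd z) * PQ p q (c z))"
    unfolding im by (intro integrable_divide Bochner_Integration.integrable_diff int)
  have fubini_snd: "(\<integral>z. f z \<partial>(hgauss \<Otimes>\<^sub>M hgauss)) = (\<integral>y. \<integral>x. f (x, y) \<partial>hgauss \<partial>hgauss)"
    if "integrable (hgauss \<Otimes>\<^sub>M hgauss) f" for f :: "real \<times> real \<Rightarrow> complex"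
    using P.integral_snd[of "curry f"] that by (simp add: curry_def)
  have fubini_fst: "(\<integral>z. f z \<partial>(hgauss \<Otimes>\<^sub>M hgauss)) = (\<integral>x. \<integral>y. f (x, y) \<partial>hgauss \<partial>hgauss)"
    if "integrable (hgauss \<Otimes>\<^sub>M hgauss) f" for f :: "real \<times> real \<Rightarrow> complex"
    using P.integral_fst'[OF that] by simp
  let ?q = "map_poly cnj q"
  have X: "(\<integral>z. complex_of_real (fst z) * PQ p q (c z) \<partial>(hgauss \<Otimes>\<^sub>M hgauss)) =
      (\<integral>z. (PQ (pderiv p) q (c z) + PQ p (pderiv q) (c z)) / 2 \<partial>(hgauss \<Otimes>\<^sub>M hgauss))"
  proof -
    have "(\<integral>z. complex_of_real (fst z) * PQ p q (c z) \<partial>(hgauss \<Otimes>\<^sub>M hgauss)) =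
        (\<integral>y. \<integral>x. complex_of_real x * PQ p q (c (x, y)) \<partial>hgauss \<partial>hgauss)"
      using fubini_snd[OF intx] by simp
    also have "\<dots> = (\<integral>y. \<integral>x. (PQ (pderiv p) q (c (x, y)) + PQ p (pderiv q) (c (x, y))) / 2 \<partial>hgauss \<partial>hgauss)"
    proof (rule Bochner_Integration.integral_cong[OF refl])
      fix y
      \<comment> \<open>The integrand on the horizontal line of height \<open>y\<close>, as a single
        polynomial in the real part.\<close>
      define P where "P = pcompose p [:\<i> * complex_of_real y, 1:] * pcompose ?q [:- (\<i> * complex_of_real y), 1:]"
      have e: "c (x, y) = \<i> * complex_of_real y + of_real x" "cnj (c (x,y)) = - (\<i> * complex_of_real y) + of_real x" for x
        by (simp_all add: c_def Complex_eq)
      have "(\<integral>x. complex_of_real x * PQ p q (c (x, y)) \<partial>hgauss) = (\<integral>x. of_real x * poly P (of_real x) \<partial>hgauss)"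
        unfolding P_def PQ_def cnj_poly e by (simp add: poly_pcompose)
      also have "\<dots> = (\<integral>x. poly (pderiv P) (of_real x) / 2 \<partial>hgauss)"
        by (simp add: hgauss_stein)
      also have "\<dots> = (\<integral>x. (PQ (pderiv p) q (c (x, y)) + PQ p (pderiv q) (c (x, y))) / 2 \<partial>hgauss)"
        unfolding P_def PQ_def cnj_poly e
        by (simp add: poly_pcompose pderiv_mult pderiv_pcompose pderiv_pCons pderiv_map_poly_cnj algebra_simps)
      finally show "(\<integral>x. complex_of_real x * PQ p q (c (x, y)) \<partial>hgauss) =
         (\<integral>x. (PQ (pderiv p) q (c (x, y)) + PQ p (pderiv q) (c (x, y))) / 2 \<partial>hgauss)" .
    qed
    also have "\<dots> = (\<integral>z. (PQ (pderiv p) q (c z) + PQ p (pderiv q) (c z)) / 2 \<partial>(hgauss \<Otimes>\<^sub>M hgauss))"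
      using int by (subst fubini_snd) auto
    finally show ?thesis .
  qed
  have Y: "(\<integral>z. complex_of_real (snd z) * PQ p q (c z) \<partial>(hgauss \<Otimes>\<^sub>M hgauss)) =
      (\<integral>z. \<i> * (PQ (pderiv p) q (c z) - PQ p (pderiv q) (c z)) / 2 \<partial>(hgauss \<Otimes>\<^sub>M hgauss))"
  proof -
    have "(\<integral>z. complex_of_real (snd z) * PQ p q (c z) \<partial>(hgauss \<Otimes>\<^sub>M hgauss)) =
        (\<integral>x. \<integral>y. complex_of_real y * PQ p q (c (x, y)) \<partial>hgauss \<partial>hgauss)"
      using fubini_fst[OF inty] by simp
    also have "\<dots> = (\<integral>x. \<integral>y. \<i> * (PQ (pderiv p) q (c (x, y)) - PQ p (pderiv q) (c (x, y))) / 2 \<partial>hgauss \<partial>hgauss)"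
    proof (rule Bochner_Integration.integral_cong[OF refl])
      fix x
      define P where "P = pcompose p [:complex_of_real x, \<i>:] * pcompose ?q [:complex_of_real x, - \<i>:]"
      have e: "c (x, y) = complex_of_real x + of_real y * \<i>" "cnj (c (x,y)) = complex_of_real x - of_real y * \<i>" for y
        by (simp_all add: c_def Complex_eq)
      have "(\<integral>y. complex_of_real y * PQ p q (c (x, y)) \<partial>hgauss) = (\<integral>y. of_real y * poly P (of_real y) \<partial>hgauss)"
        unfolding P_def PQ_def cnj_poly e by (simp add: poly_pcompose)
      also have "\<dots> = (\<integral>y. poly (pderiv P) (of_real y) / 2 \<partial>hgauss)"
        by (simp add: hgauss_stein)
      also have "\<dots> = (\<integral>y. \<i> * (PQ (pderiv p) q (c (x, y)) - PQ p (pderiv q) (c (x, y))) / 2 \<partial>hgauss)"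
        unfolding P_def PQ_def cnj_poly e
        by (simp add: poly_pcompose pderiv_mult pderiv_pcompose pderiv_pCons pderiv_map_poly_cnj algebra_simps)
      finally show "(\<integral>y. complex_of_real y * PQ p q (c (x, y)) \<partial>hgauss) =
         (\<integral>y. \<i> * (PQ (pderiv p) q (c (x, y)) - PQ p (pderiv q) (c (x, y))) / 2 \<partial>hgauss)" .
    qed
    also have "\<dots> = (\<integral>z. \<i> * (PQ (pderiv p) q (c z) - PQ p (pderiv q) (c z)) / 2 \<partial>(hgauss \<Otimes>\<^sub>M hgauss))"
      using int by (subst fubini_fst) auto
    finally show ?thesis .
  qed
  have "(\<integral>w. w * PQ p q w \<partial>cgauss) = (\<integral>z. c z * PQ p q (c z) \<partial>(hgauss \<Otimes>\<^sub>M hgauss))"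
    by (rule cg) measurable
  also have "\<dots> = (\<integral>z. complex_of_real (fst z) * PQ p q (c z) + \<i> * (complex_of_real (snd z) * PQ p q (c z)) \<partial>(hgauss \<Otimes>\<^sub>M hgauss))"
    by (intro Bochner_Integration.integral_cong) (simp_all add: c_def Complex_eq algebra_simps)
  also have "\<dots> = (\<integral>z. complex_of_real (fst z) * PQ p q (c z) \<partial>(hgauss \<Otimes>\<^sub>M hgauss)) +
      \<i> * (\<integral>z. complex_of_real (snd z) * PQ p q (c z) \<partial>(hgauss \<Otimes>\<^sub>M hgauss))"
    using intx inty by (subst Bochner_Integration.integral_add) auto
  also have "\<dots> = (\<integral>z. (PQ (pderiv p) q (c z) + PQ p (pderiv q) (c z)) / 2 +
      \<i> * (\<i> * (PQ (pderiv p) q (c z) - PQ p (pderiv q) (c z)) / 2) \<partial>(hgauss \<Otimes>\<^sub>M hgauss))"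
    unfolding X Y using int by (subst Bochner_Integration.integral_add) auto
  also have "\<dots> = (\<integral>z. PQ p (pderiv q) (c z) \<partial>(hgauss \<Otimes>\<^sub>M hgauss))"
    by (intro Bochner_Integration.integral_cong) (simp_all add: field_simps)
  also have "\<dots> = (\<integral>w. PQ p (pderiv q) w \<partial>cgauss)"
    by (rule cg[symmetric]) measurable
  finally show ?thesis unfolding PQ_def .
qed

section \<open>Wick's formula\<close>

abbreviation clin :: "nat \<Rightarrow> (nat \<Rightarrow> real) \<Rightarrow> (nat \<Rightarrow> complex) \<Rightarrow> complex" where
  "clin n a z \<equiv> (\<Sum>l<n. complex_of_real (a l) * z l)"

interpretation cgauss_prod: product_prob_space "\<lambda>_::nat. cgauss" UNIV ..

text \<open>The bound is a product over coordinates, so its powers integrate factor by factor under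
  the product measure.\<close>

lemma norm_clin_le: "cmod (clin n a z) \<le> (\<Sum>l<n. \<bar>a l\<bar>) * (\<Prod>l<n. 1 + cmod (z l))"
proof -
  have "cmod (clin n a z) \<le> (\<Sum>l<n. \<bar>a l\<bar> * cmod (z l))"
    by (intro sum_norm_le) (simp add: norm_mult)
  also have "\<dots> \<le> (\<Sum>l<n. \<bar>a l\<bar> * (\<Prod>l<n. 1 + cmod (z l)))"
  proof (intro sum_mono mult_left_mono)
    fix l assume "l \<in> {..<n}"
    then have "(\<Prod>l<n. 1 + cmod (z l)) = (1 + cmod (z l)) * (\<Prod>l\<in>{..<n}-{l}. 1 + cmod (z l))"
      by (subst prod.remove) auto
    moreover have "1 \<le> (\<Prod>l\<in>{..<n}-{l}. 1 + cmod (z l))" by (intro prod_ge_1) auto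
    ultimately show "cmod (z l) \<le> (\<Prod>l<n. 1 + cmod (z l))"
      using mult_left_mono[of 1 "\<Prod>l\<in>{..<n}-{l}. 1 + cmod (z l)" "1 + cmod (z l)"] by simp
  qed auto
  finally show ?thesis by (simp add: sum_distrib_right)
qed

lemma clin_measurable [measurable]: "clin n a \<in> borel_measurable (cgauss_vec n)"
  unfolding cgauss_vec_def by measurable

lemma cgauss_vec_integrable:
  fixes I J :: "nat set"
  shows "integrable (cgauss_vec n) (\<lambda>z. (\<Prod>i\<in>I. clin n (a i) z) * cnj (\<Prod>j\<in>J. clin n (b j) z))"
proof -
  define A where "A = (\<lambda>a::nat\<Rightarrow>real. \<Sum>l<n. \<bar>a l\<bar>)"
  define W where "W = (\<lambda>z::nat\<Rightarrow>complex. \<Prod>l<n. 1 + cmod (z l))"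
  have W0: "W z \<ge> 0" for z unfolding W_def by (intro prod_nonneg) auto
  have A0: "A a \<ge> 0" for a unfolding A_def by (intro sum_nonneg) auto
  have bound: "cmod (\<Prod>i\<in>I. clin n (a i) z) \<le> (\<Prod>i\<in>I. A (a i)) * W z ^ card I" for I :: "nat set" and a z
  proof -
    have "cmod (\<Prod>i\<in>I. clin n (a i) z) \<le> (\<Prod>i\<in>I. A (a i) * W z)"
      unfolding A_def W_def
      by (subst prod_norm[symmetric]) (intro prod_mono conjI norm_ge_zero norm_clin_le)
    then show ?thesis by (simp add: prod.distrib)
  qed
  have "integrable (cgauss_vec n) (\<lambda>z. ((\<Prod>i\<in>I. A (a i)) * (\<Prod>j\<in>J. A (b j))) * (\<Prod>l<n. (1 + cmod (z l)) ^ (card I + card J)))"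
    unfolding cgauss_vec_def
    by (intro integrable_mult_right cgauss_prod.product_integrable_prod cgauss_integrable_weight) auto
  then show ?thesis
  proof (rule Bochner_Integration.integrable_bound)
    have "cmod ((\<Prod>i\<in>I. clin n (a i) z) * cnj (\<Prod>j\<in>J. clin n (b j) z)) \<le>
       ((\<Prod>i\<in>I. A (a i)) * (\<Prod>j\<in>J. A (b j))) * (\<Prod>l<n. (1 + cmod (z l)) ^ (card I + card J))" for z
    proof -
      have "cmod ((\<Prod>i\<in>I. clin n (a i) z) * cnj (\<Prod>j\<in>J. clin n (b j) z)) \<le>
         ((\<Prod>i\<in>I. A (a i)) * W z ^ card I) * ((\<Prod>j\<in>J. A (b j)) * W z ^ card J)"
        unfolding norm_mult complex_mod_cnj
        by (intro mult_mono bound mult_nonneg_nonneg prod_nonneg zero_le_power A0 W0 norm_ge_zero)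
      also have "\<dots> = ((\<Prod>i\<in>I. A (a i)) * (\<Prod>j\<in>J. A (b j))) * W z ^ (card I + card J)"
        by (simp add: power_add algebra_simps)
      finally show ?thesis unfolding W_def by (simp add: prod_power_distrib)
    qed
    then show "AE z in cgauss_vec n. norm ((\<Prod>i\<in>I. clin n (a i) z) * cnj (\<Prod>j\<in>J. clin n (b j) z))
      \<le> norm (((\<Prod>i\<in>I. A (a i)) * (\<Prod>j\<in>J. A (b j))) * (\<Prod>l<n. (1 + cmod (z l)) ^ (card I + card J)))"
      unfolding real_norm_def by (intro AE_I2 order_trans[OF _ abs_ge_self])
  qed measurable
qed

lemma clin_unit: "l < n \<Longrightarrow> clin n (\<lambda>l'. if l' = l then 1 else 0) z = z l"
proof -
  assume l: "l < n"
  have "clin n (\<lambda>l'. if l' = l then 1 else 0) z = (\<Sum>l'<n. if l' = l then z l' else 0)"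
    by (intro sum.cong) auto
  then show ?thesis using l by simp
qed

lemma cgauss_vec_integrable_coord:
  fixes I J :: "nat set"
  assumes "l < n" "finite I"
  shows "integrable (cgauss_vec n) (\<lambda>z. z l * ((\<Prod>i\<in>I. clin n (a i) z) * cnj (\<Prod>j\<in>J. clin n (b j) z)))"
proof -
  \<comment> \<open>The coordinate \<open>z l\<close> is itself a linear form, with a unit
    coefficient vector. It is added to the product under a fresh index, and the previous lemma
    applies.\<close>
  obtain i0 where i0: "i0 \<notin> I" using ex_new_if_finite[OF infinite_UNIV_nat assms(2)] by auto
  define a' where "a' = a(i0 := (\<lambda>l'. if l' = l then 1 else 0))"
  have "(\<Prod>i\<in>insert i0 I. clin n (a' i) z) = z l * (\<Prod>i\<in>I. clin n (a i) z)" for z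
  proof -
    have "(\<Prod>i\<in>insert i0 I. clin n (a' i) z) = clin n (a' i0) z * (\<Prod>i\<in>I. clin n (a' i) z)"
      using i0 assms(2) by simp
    also have "(\<Prod>i\<in>I. clin n (a' i) z) = (\<Prod>i\<in>I. clin n (a i) z)"
      using i0 by (intro prod.cong) (auto simp: a'_def)
    also have "clin n (a' i0) z = z l" unfolding a'_def fun_upd_same by (rule clin_unit[OF assms(1)])
    finally show ?thesis .
  qed
  then show ?thesis using cgauss_vec_integrable[of n a' "insert i0 I" b J] by (simp add: mult.assoc)
qed

text \<open>With the other coordinates frozen, every linear form is a polynomial of degree at most
  one in \<open>z l\<close>. Then \<open>cgauss_stein\<close> differentiates the conjugated product,
  and the product rule deletes one factor \<open>j\<close> at a time, leaving its coefficient
  \<open>b j l\<close>.\<close>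

lemma wick_coord:
  fixes I J :: "nat set"
  assumes l: "l < n" and fin: "finite I" "finite J"
  shows "(\<integral>z. z l * ((\<Prod>i\<in>I. clin n (a i) z) * cnj (\<Prod>j\<in>J. clin n (b j) z)) \<partial>cgauss_vec n) =
    (\<Sum>j\<in>J. b j l * (\<integral>z. (\<Prod>i\<in>I. clin n (a i) z) * cnj (\<Prod>j\<in>J-{j}. clin n (b j) z) \<partial>cgauss_vec n))"
proof -
  define R where "R = {..<n} - {l}"
  have R: "{..<n} = insert l R" "l \<notin> R" "finite R" using l by (auto simp: R_def)
  define r where "r = (\<lambda>a z. \<Sum>l'\<in>R. complex_of_real (a l') * z l')"
  have upd: "clin n a (z(l := y)) = poly [:r a z, of_real (a l):] y" for a :: "nat \<Rightarrow> real" and z y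
  proof -
    have "(\<Sum>l'\<in>R. complex_of_real (a l') * (z(l := y)) l') = r a z"
      unfolding r_def using R by (intro sum.cong) auto
    then show ?thesis unfolding R(1) using R by simp
  qed
  have int: "integrable (cgauss_vec n) (\<lambda>z. of_real (b j l) * ((\<Prod>i\<in>I. clin n (a i) z) * cnj (\<Prod>j\<in>J-{j}. clin n (b j) z)))" for j
    by (intro integrable_mult_right cgauss_vec_integrable)
  have insert_eq: "integral\<^sup>L (cgauss_vec n) f = (\<integral>x. (\<integral>y. f (x(l:=y)) \<partial>cgauss) \<partial>PiM R (\<lambda>_. cgauss))"
    if "integrable (cgauss_vec n) f" for f :: "(nat \<Rightarrow> complex) \<Rightarrow> complex"
    using cgauss_prod.product_integral_insert[OF R(3,2), of f] that unfolding cgauss_vec_def R(1)[symmetric] by simp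
  have "(\<integral>z. z l * ((\<Prod>i\<in>I. clin n (a i) z) * cnj (\<Prod>j\<in>J. clin n (b j) z)) \<partial>cgauss_vec n) =
    (\<integral>x. (\<integral>y. y * ((\<Prod>i\<in>I. clin n (a i) (x(l:=y))) * cnj (\<Prod>j\<in>J. clin n (b j) (x(l:=y)))) \<partial>cgauss) \<partial>PiM R (\<lambda>_. cgauss))"
    by (subst insert_eq[OF cgauss_vec_integrable_coord[OF l fin(1)]]) simp
  also have "\<dots> = (\<integral>x. (\<integral>y. (\<Sum>j\<in>J. of_real (b j l) * ((\<Prod>i\<in>I. clin n (a i) (x(l:=y))) *
       cnj (\<Prod>j\<in>J-{j}. clin n (b j) (x(l:=y))))) \<partial>cgauss) \<partial>PiM R (\<lambda>_. cgauss))"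
  proof (rule Bochner_Integration.integral_cong[OF refl])
    fix x
    define p where "p = (\<Prod>i\<in>I. [:r (a i) x, of_real (a i l):])"
    define q where "q = (\<lambda>J. \<Prod>j\<in>J. [:r (b j) x, of_real (b j l):])"
    have "(\<integral>y. y * ((\<Prod>i\<in>I. clin n (a i) (x(l:=y))) * cnj (\<Prod>j\<in>J. clin n (b j) (x(l:=y)))) \<partial>cgauss) =
       (\<integral>y. y * (poly p y * cnj (poly (q J) y)) \<partial>cgauss)"
      unfolding upd by (simp add: p_def q_def poly_prod)
    also have "\<dots> = (\<integral>y. poly p y * cnj (poly (pderiv (q J)) y) \<partial>cgauss)"
      by (rule cgauss_stein)
    also have "\<dots> = (\<integral>y. (\<Sum>j\<in>J. of_real (b j l) * (poly p y * cnj (poly (q (J-{j})) y))) \<partial>cgauss)"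
      unfolding q_def by (simp add: pderiv_prod pderiv_pCons poly_sum sum_distrib_left algebra_simps del: cnj_sum)
        (simp add: algebra_simps sum_distrib_left)
    also have "\<dots> = (\<integral>y. (\<Sum>j\<in>J. of_real (b j l) * ((\<Prod>i\<in>I. clin n (a i) (x(l:=y))) *
       cnj (\<Prod>j\<in>J-{j}. clin n (b j) (x(l:=y))))) \<partial>cgauss)"
      unfolding upd by (simp add: p_def q_def poly_prod)
    finally show "(\<integral>y. y * ((\<Prod>i\<in>I. clin n (a i) (x(l:=y))) * cnj (\<Prod>j\<in>J. clin n (b j) (x(l:=y)))) \<partial>cgauss) =
      (\<integral>y. (\<Sum>j\<in>J. of_real (b j l) * ((\<Prod>i\<in>I. clin n (a i) (x(l:=y))) *
       cnj (\<Prod>j\<in>J-{j}. clin n (b j) (x(l:=y))))) \<partial>cgauss)" .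
  qed
  also have "\<dots> = (\<integral>z. (\<Sum>j\<in>J. of_real (b j l) * ((\<Prod>i\<in>I. clin n (a i) z) *
       cnj (\<Prod>j\<in>J-{j}. clin n (b j) z))) \<partial>cgauss_vec n)"
    by (rule insert_eq[symmetric], rule Bochner_Integration.integrable_sum, rule int)
  also have "\<dots> = (\<Sum>j\<in>J. b j l * (\<integral>z. (\<Prod>i\<in>I. clin n (a i) z) * cnj (\<Prod>j\<in>J-{j}. clin n (b j) z) \<partial>cgauss_vec n))"
    by (subst Bochner_Integration.integral_sum[OF int]) (subst integral_mult_right_zero, rule refl)
  finally show ?thesis .
qed

text \<open>Summing \<open>wick_coord\<close> over the coordinates with weights \<open>c l\<close>
  assembles the coefficients into scalar products: the form \<open>c\<close> is contracted with each
  conjugated form in turn.\<close>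

lemma wick_step:
  fixes I J :: "nat set"
  assumes fin: "finite I" "finite J"
  shows "(\<integral>z. clin n c z * ((\<Prod>i\<in>I. clin n (a i) z) * cnj (\<Prod>j\<in>J. clin n (b j) z)) \<partial>cgauss_vec n) =
    (\<Sum>j\<in>J. rdot n c (b j) * (\<integral>z. (\<Prod>i\<in>I. clin n (a i) z) * cnj (\<Prod>j\<in>J-{j}. clin n (b j) z) \<partial>cgauss_vec n))"
proof -
  define T where "T = (\<lambda>z. (\<Prod>i\<in>I. clin n (a i) z) * cnj (\<Prod>j\<in>J. clin n (b j) z))"
  define E where "E = (\<lambda>j. \<integral>z. (\<Prod>i\<in>I. clin n (a i) z) * cnj (\<Prod>j\<in>J-{j}. clin n (b j) z) \<partial>cgauss_vec n)"
  have "(\<integral>z. clin n c z * T z \<partial>cgauss_vec n) = (\<integral>z. (\<Sum>l<n. of_real (c l) * (z l * T z)) \<partial>cgauss_vec n)"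
    by (simp add: sum_distrib_right mult.assoc)
  also have "\<dots> = (\<Sum>l<n. of_real (c l) * (\<integral>z. z l * T z \<partial>cgauss_vec n))"
    unfolding T_def by (subst Bochner_Integration.integral_sum)
       (auto intro!: cgauss_vec_integrable_coord integrable_mult_right assms simp del: cnj_prod complex_cnj_mult)
  also have "\<dots> = (\<Sum>l<n. of_real (c l) * (\<Sum>j\<in>J. b j l * E j))"
    unfolding T_def E_def by (intro sum.cong refl arg_cong2[where f="(*)"] wick_coord fin) auto
  also have "\<dots> = (\<Sum>j\<in>J. \<Sum>l<n. of_real (c l) * of_real (b j l) * E j)"
    by (subst sum.swap) (simp add: sum_distrib_left mult.assoc)
  also have "\<dots> = (\<Sum>j\<in>J. rdot n c (b j) * E j)"
    by (simp add: rdot_def sum_distrib_right)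
  finally show ?thesis unfolding T_def E_def .
qed

text \<open>If \<open>card J = length is\<close>, this is the permanent of the submatrix with rows
  \<open>is\<close> and columns \<open>J\<close>, expanded along its rows. One recursion step
  matches one contraction in \<open>wick_step\<close>.\<close>

fun perm_list :: "(nat \<Rightarrow> nat \<Rightarrow> real) \<Rightarrow> nat list \<Rightarrow> nat set \<Rightarrow> real" where
  "perm_list c [] J = 1"
| "perm_list c (i # is) J = (\<Sum>j\<in>J. c i j * perm_list c is (J - {j}))"

lemma wick:
  assumes "distinct is" "finite J" "card J = length is"
  shows "(\<integral>z. (\<Prod>i\<in>set is. clin n (a i) z) * cnj (\<Prod>j\<in>J. clin n (b j) z) \<partial>cgauss_vec n) =
    of_real (perm_list (\<lambda>i j. rdot n (a i) (b j)) is J)"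
  using assms
proof (induction "is" arbitrary: J)
  case Nil
  interpret prob_space "cgauss_vec n" unfolding cgauss_vec_def by (intro prob_space_PiM prob_space_cgauss)
  from Nil show ?case by (simp add: prob_space)
next
  case (Cons i "is")
  have "(\<integral>z. (\<Prod>i\<in>set (i # is). clin n (a i) z) * cnj (\<Prod>j\<in>J. clin n (b j) z) \<partial>cgauss_vec n) =
      (\<integral>z. clin n (a i) z * ((\<Prod>i\<in>set is. clin n (a i) z) * cnj (\<Prod>j\<in>J. clin n (b j) z)) \<partial>cgauss_vec n)"
    using Cons.prems by (simp add: mult.assoc)
  also have "\<dots> = (\<Sum>j\<in>J. rdot n (a i) (b j) *
      (\<integral>z. (\<Prod>i\<in>set is. clin n (a i) z) * cnj (\<Prod>j\<in>J-{j}. clin n (b j) z) \<partial>cgauss_vec n))"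
    using Cons.prems by (intro wick_step) auto
  also have "\<dots> = (\<Sum>j\<in>J. of_real (rdot n (a i) (b j)) * complex_of_real (perm_list (\<lambda>i j. rdot n (a i) (b j)) is (J - {j})))"
    using Cons.prems by (intro sum.cong refl arg_cong2[where f="(*)"] Cons.IH) auto
  finally show ?case by simp
qed

text \<open>The inner product as a function of the matrix of scalar products alone. The full and the
  restricted inner product are its values at two matrices, so only the matrix entries have to be
  compared.\<close>

definition perm_form :: "nat \<Rightarrow> nat \<Rightarrow> (nat set \<Rightarrow> real) \<Rightarrow> (nat set \<Rightarrow> real) \<Rightarrow> (nat \<Rightarrow> nat \<Rightarrow> real) \<Rightarrow> real" where
  "perm_form N m \<alpha> \<beta> c =
    (\<Sum>I\<in>msubsets N m. \<Sum>J\<in>msubsets N m. \<alpha> I * \<beta> J * perm_list c (sorted_list_of_set I) J)"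

lemma msubsetsD: "I \<in> msubsets N m \<Longrightarrow> finite I \<and> I \<subseteq> {..<N} \<and> card I = m"
  by (auto simp: msubsets_def intro: finite_subset)

lemma gip_cpoly:
  "gip n (cpoly n N m a \<alpha>) (cpoly n N m b \<beta>) = of_real (perm_form N m \<alpha> \<beta> (\<lambda>i j. rdot n (a i) (b j)))"
proof -
  define T where "T = (\<lambda>I J z. (\<Prod>i\<in>I. clin n (a i) z) * cnj (\<Prod>j\<in>J. clin n (b j) z))"
  have int: "integrable (cgauss_vec n) (\<lambda>z. of_real (\<alpha> I * \<beta> J) * T I J z)" for I J
    unfolding T_def by (intro integrable_mult_right cgauss_vec_integrable)
  have "gip n (cpoly n N m a \<alpha>) (cpoly n N m b \<beta>) =
     (\<integral>z. (\<Sum>I\<in>msubsets N m. \<Sum>J\<in>msubsets N m. of_real (\<alpha> I * \<beta> J) * T I J z) \<partial>cgauss_vec n)"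
    unfolding gip_def cpoly_def T_def
    by (simp add: sum_product cnj_sum algebra_simps)
  also have "\<dots> = (\<Sum>I\<in>msubsets N m. \<Sum>J\<in>msubsets N m. of_real (\<alpha> I * \<beta> J) * (\<integral>z. T I J z \<partial>cgauss_vec n))"
    by (subst Bochner_Integration.integral_sum, intro Bochner_Integration.integrable_sum int,
        intro sum.cong refl, subst Bochner_Integration.integral_sum, rule int,
        intro sum.cong refl integral_mult_right_zero)
  also have "\<dots> = (\<Sum>I\<in>msubsets N m. \<Sum>J\<in>msubsets N m.
      of_real (\<alpha> I * \<beta> J * perm_list (\<lambda>i j. rdot n (a i) (b j)) (sorted_list_of_set I) J))"
  proof (intro sum.cong refl)
    fix I J assume "I \<in> msubsets N m" "J \<in> msubsets N m"
    from this[THEN msubsetsD] show "of_real (\<alpha> I * \<beta> J) * (\<integral>z. T I J z \<partial>cgauss_vec n) =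
      of_real (\<alpha> I * \<beta> J * perm_list (\<lambda>i j. rdot n (a i) (b j)) (sorted_list_of_set I) J)"
      unfolding T_def using wick[of "sorted_list_of_set I" J n a b] by simp
  qed
  finally show ?thesis by (simp add: perm_form_def)
qed

section \<open>Gram--Schmidt and restriction to subspaces\<close>

lemma perm_list_nonneg:
  assumes "\<And>i j. i \<in> set is \<Longrightarrow> j \<in> J \<Longrightarrow> 0 \<le> c i j"
  shows "0 \<le> perm_list c is J"
  using assms
proof (induction "is" arbitrary: J)
  case (Cons i "is")
  have "0 \<le> c i j * perm_list c is (J - {j})" if "j \<in> J" for j
    using Cons.prems that by (intro mult_nonneg_nonneg Cons.IH) auto
  then show ?case by (simp add: sum_nonneg)
qed simp

text \<open>A permanent has no signs, so it increases with each entry as long as the entries are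
  nonnegative. This is where the positivity in the focused condition becomes decisive.\<close>

lemma perm_list_mono:
  assumes "\<And>i j. i \<in> set is \<Longrightarrow> j \<in> J \<Longrightarrow> 0 \<le> c i j \<and> c i j \<le> d i j"
  shows "perm_list c is J \<le> perm_list d is J"
  using assms
proof (induction "is" arbitrary: J)
  case (Cons i "is")
  have "c i j * perm_list c is (J - {j}) \<le> d i j * perm_list d is (J - {j})" if "j \<in> J" for j
  proof (rule mult_mono)
    show "c i j \<le> d i j" "0 \<le> d i j" using Cons.prems[of i j] that by auto
    show "perm_list c is (J - {j}) \<le> perm_list d is (J - {j})" using Cons.prems by (intro Cons.IH) auto
    show "0 \<le> perm_list c is (J - {j})" using Cons.prems by (intro perm_list_nonneg) auto
  qed
  then show ?case by (auto intro: sum_mono)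
qed simp

text \<open>One factor per row: the source of the \<open>m\<close>-th powers in the theorem.\<close>

lemma perm_list_scale: "perm_list (\<lambda>i j. s * c i j) is J = s ^ length is * perm_list c is J"
  by (induction "is" arbitrary: J) (simp_all add: sum_distrib_left algebra_simps)

lemma perm_form_mono:
  assumes "\<And>i j. i < N \<Longrightarrow> j < N \<Longrightarrow> 0 \<le> c i j \<and> c i j \<le> d i j"
    and "\<forall>I\<in>msubsets N m. \<alpha> I \<ge> 0" "\<forall>J\<in>msubsets N m. \<beta> J \<ge> 0"
  shows "perm_form N m \<alpha> \<beta> c \<le> perm_form N m \<alpha> \<beta> d"
  unfolding perm_form_def
proof (intro sum_mono mult_left_mono perm_list_mono)
  fix I J i j assume I: "I \<in> msubsets N m" "J \<in> msubsets N m"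
  { assume "i \<in> set (sorted_list_of_set I)" "j \<in> J"
    with I[THEN msubsetsD] have "i < N" "j < N" by auto
    then show "0 \<le> c i j \<and> c i j \<le> d i j" by (rule assms) }
  show "0 \<le> \<alpha> I * \<beta> J" using I assms by auto
qed

lemma perm_form_scale: "perm_form N m \<alpha> \<beta> (\<lambda>i j. s * c i j) = s ^ m * perm_form N m \<alpha> \<beta> c"
proof -
  have "perm_form N m \<alpha> \<beta> (\<lambda>i j. s * c i j) =
     (\<Sum>I\<in>msubsets N m. \<Sum>J\<in>msubsets N m. s ^ m * (\<alpha> I * \<beta> J * perm_list c (sorted_list_of_set I) J))"
    unfolding perm_form_def perm_list_scale
    by (intro sum.cong refl) (auto dest: msubsetsD)
  then show ?thesis by (simp add: perm_form_def sum_distrib_left)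
qed

section \<open>Orthogonal systems and their spans\<close>

lemma rdot_commute: "rdot n x y = rdot n y x"
  by (simp add: rdot_def mult.commute)

lemma rdot_self_nonneg [simp]: "0 \<le> rdot n x x"
  by (auto simp: rdot_def intro: sum_nonneg)

lemma rdot_self_eq_0: "rdot n x x = 0 \<longleftrightarrow> (\<forall>l<n. x l = 0)"
  unfolding rdot_def by (subst sum_nonneg_eq_0_iff) auto

lemma rdot_zero_left: "rdot n x x = 0 \<Longrightarrow> rdot n x y = 0"
  unfolding rdot_self_eq_0 by (simp add: rdot_def)

lemma rdot_cong: "(\<And>l. l < n \<Longrightarrow> x l = x' l) \<Longrightarrow> (\<And>l. l < n \<Longrightarrow> y l = y' l) \<Longrightarrow> rdot n x y = rdot n x' y'"
  by (simp add: rdot_def)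

lemma rdot_diff_left: "rdot n (\<lambda>l. x l - y l) z = rdot n x z - rdot n y z"
  and rdot_add_left: "rdot n (\<lambda>l. x l + y l) z = rdot n x z + rdot n y z"
  and rdot_scale_left: "rdot n (\<lambda>l. c * x l) z = c * rdot n x z"
  and rdot_divide_left: "rdot n (\<lambda>l. x l / c) z = rdot n x z / c"
  by (simp_all add: rdot_def algebra_simps sum_subtractf sum.distrib sum_distrib_left sum_divide_distrib)

lemma rdot_sum_left: "rdot n (\<lambda>l. \<Sum>i\<in>A. f i l) z = (\<Sum>i\<in>A. rdot n (f i) z)"
  unfolding rdot_def sum_distrib_right by (rule sum.swap)

lemma rdot_lincomb: "rdot n (\<lambda>l. \<Sum>i\<in>A. c i * u i l) z = (\<Sum>i\<in>A. c i * rdot n (u i) z)"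
  by (simp add: rdot_sum_left rdot_scale_left)

lemma rdot_lincomb_right: "rdot n z (\<lambda>l. \<Sum>i\<in>A. c i * u i l) = (\<Sum>i\<in>A. c i * rdot n z (u i))"
  by (simp add: rdot_commute[of n z] rdot_lincomb)

text \<open>The component of \<open>x\<close> orthogonal to the system, when \<open>u\<close> is an
  orthogonal system in the sense below.\<close>

definition residual :: "nat \<Rightarrow> nat \<Rightarrow> (nat \<Rightarrow> nat \<Rightarrow> real) \<Rightarrow> (nat \<Rightarrow> real) \<Rightarrow> nat \<Rightarrow> real" where
  "residual n d u x = (\<lambda>l. x l - (\<Sum>i<d. rdot n x (u i) * u i l))"

definition orthosystem :: "nat \<Rightarrow> nat \<Rightarrow> (nat \<Rightarrow> nat \<Rightarrow> real) \<Rightarrow> bool" where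
  "orthosystem n d u \<longleftrightarrow> (\<forall>i<d. \<forall>j<d. i \<noteq> j \<longrightarrow> rdot n (u i) (u j) = 0) \<and>
     (\<forall>i<d. rdot n (u i) (u i) \<in> {0, 1})"

definition orthonormal :: "nat \<Rightarrow> nat \<Rightarrow> (nat \<Rightarrow> nat \<Rightarrow> real) \<Rightarrow> bool" where
  "orthonormal n d u \<longleftrightarrow> (\<forall>i<d. \<forall>j<d. rdot n (u i) (u j) = (if i = j then 1 else 0))"

lemma orthonormal_orthosystem: "orthonormal n d u \<Longrightarrow> orthosystem n d u"
  by (auto simp: orthonormal_def orthosystem_def)

lemma orthosystem_lincomb:
  assumes "orthosystem n d u" "j < d"
  shows "rdot n (\<lambda>l. \<Sum>i<d. c i * u i l) (u j) = c j * rdot n (u j) (u j)"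
proof -
  have "(\<Sum>i<d. c i * rdot n (u i) (u j)) = (\<Sum>i<d. if i = j then c j * rdot n (u j) (u j) else 0)"
    using assms by (intro sum.cong refl) (auto simp: orthosystem_def)
  then show ?thesis using assms by (simp add: rdot_lincomb)
qed

text \<open>Either \<open>u j\<close> is a unit vector, or it vanishes on the first \<open>n\<close>
  coordinates and both sides are 0.\<close>

lemma orthosystem_coeff:
  assumes "orthosystem n d u" "j < d"
  shows "rdot n x (u j) * rdot n (u j) (u j) = rdot n x (u j)"
  using assms rdot_zero_left[of n "u j" x] by (auto simp: orthosystem_def rdot_commute[of n x])

lemma residual_orthogonal:
  assumes "orthosystem n d u" "j < d"
  shows "rdot n (residual n d u x) (u j) = 0"
  unfolding residual_def rdot_diff_left orthosystem_lincomb[OF assms] orthosystem_coeff[OF assms] by simp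

lemma rdot_residual:
  assumes "orthosystem n d u"
  shows "rdot n (residual n d u x) (residual n d u x) = rdot n x x - (\<Sum>i<d. (rdot n x (u i))\<^sup>2)"
proof -
  have "rdot n (residual n d u x) (residual n d u x) = rdot n (residual n d u x) x -
       rdot n (residual n d u x) (\<lambda>l. \<Sum>i<d. rdot n x (u i) * u i l)"
    by (simp add: residual_def[of n d u x] rdot_commute[of n _ "\<lambda>l. x l - _ l"] rdot_diff_left rdot_commute)
  also have "rdot n (residual n d u x) (\<lambda>l. \<Sum>i<d. rdot n x (u i) * u i l) = 0"
    unfolding rdot_lincomb_right using residual_orthogonal[OF assms] by simp
  also have "rdot n (residual n d u x) x = rdot n x x - (\<Sum>i<d. (rdot n x (u i))\<^sup>2)"
    by (simp add: residual_def rdot_diff_left rdot_lincomb power2_eq_square rdot_commute[of n "u _"])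
  finally show ?thesis by simp
qed

lemma bessel:
  assumes "orthosystem n d u"
  shows "(\<Sum>i<d. (rdot n x (u i))\<^sup>2) \<le> rdot n x x"
  using rdot_residual[OF assms, of x] rdot_self_nonneg[of n "residual n d u x"] by simp

lemma lspan_parseval:
  assumes "orthosystem n d u" "x \<in> lspan n d u"
  shows "rdot n x x = (\<Sum>i<d. (rdot n x (u i))\<^sup>2)"
proof -
  obtain c where c: "\<And>l. l < n \<Longrightarrow> x l = (\<Sum>i<d. c i * u i l)" using assms(2) by (auto simp: lspan_def)
  have x: "rdot n x y = (\<Sum>i<d. c i * rdot n (u i) y)" for y
    using rdot_cong[of n x "\<lambda>l. \<Sum>i<d. c i * u i l" y y] c by (simp add: rdot_lincomb)
  have "rdot n x (u i) = c i * rdot n (u i) (u i)" if "i < d" for i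
    using rdot_cong[of n x "\<lambda>l. \<Sum>i<d. c i * u i l" "u i" "u i"] c orthosystem_lincomb[OF assms(1) that] by simp
  then have "c i * rdot n (u i) x = (rdot n x (u i))\<^sup>2" if "i < d" for i
    using that orthosystem_coeff[OF assms(1) that, of x] assms(1)
    by (auto simp: power2_eq_square rdot_commute[of n "u i" x] orthosystem_def)
  then show ?thesis by (simp add: x[of x])
qed

text \<open>Polarized Parseval identity. Only \<open>x\<close> has to lie in the span, so in
  \<open>proj_form_onb\<close> a basis vector can be paired with an arbitrary vector.\<close>

lemma lspan_expand:
  assumes "orthonormal n d u" "x \<in> lspan n d u"
  shows "rdot n x y = (\<Sum>i<d. rdot n x (u i) * rdot n (u i) y)"
proof -
  obtain c where c: "\<And>l. l < n \<Longrightarrow> x l = (\<Sum>i<d. c i * u i l)" using assms(2) by (auto simp: lspan_def)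
  have "rdot n x (u i) = c i" if "i < d" for i
    using rdot_cong[of n x "\<lambda>l. \<Sum>i<d. c i * u i l" "u i" "u i"] c assms(1) that
      orthosystem_lincomb[OF orthonormal_orthosystem[OF assms(1)] that, of c]
    by (simp add: orthonormal_def)
  moreover have "rdot n x y = (\<Sum>i<d. c i * rdot n (u i) y)"
    using rdot_cong[of n x "\<lambda>l. \<Sum>i<d. c i * u i l" y y] c by (simp add: rdot_lincomb)
  ultimately show ?thesis by simp
qed

lemma lspan_base: "j < d \<Longrightarrow> u j \<in> lspan n d u"
proof -
  assume j: "j < d"
  have "(\<Sum>i<d. (if i = j then 1 else 0) * u i l) = (\<Sum>i<d. if i = j then u j l else 0)" for l
    by (intro sum.cong) auto
  then show ?thesis using j unfolding lspan_def
    by (intro CollectI exI[of _ "\<lambda>i. if i = j then 1 else 0"]) simp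
qed

lemma lspan_lincomb:
  assumes "\<And>i. i \<in> A \<Longrightarrow> f i \<in> lspan n d u" and x: "\<And>l. l < n \<Longrightarrow> x l = (\<Sum>i\<in>A. c i * f i l)"
  shows "x \<in> lspan n d u"
proof -
  have "\<forall>i\<in>A. \<exists>e. \<forall>l<n. f i l = (\<Sum>j<d. e j * u j l)" using assms(1) by (auto simp: lspan_def)
  then obtain e where e: "\<And>i l. i \<in> A \<Longrightarrow> l < n \<Longrightarrow> f i l = (\<Sum>j<d. e i j * u j l)" by metis
  have "x l = (\<Sum>j<d. (\<Sum>i\<in>A. c i * e i j) * u j l)" if "l < n" for l
  proof -
    have "x l = (\<Sum>i\<in>A. \<Sum>j<d. c i * e i j * u j l)"
      using x[OF that] e[OF _ that] by (simp add: sum_distrib_left mult.assoc)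
    also have "\<dots> = (\<Sum>j<d. (\<Sum>i\<in>A. c i * e i j) * u j l)"
      by (subst sum.swap) (simp add: sum_distrib_right)
    finally show ?thesis .
  qed
  then show ?thesis by (auto simp: lspan_def)
qed

lemma lspan_subset:
  assumes "\<And>j. j < d \<Longrightarrow> X j \<in> lspan n e Y"
  shows "lspan n d X \<subseteq> lspan n e Y"
proof
  fix x assume "x \<in> lspan n d X"
  then obtain c where "\<And>l. l < n \<Longrightarrow> x l = (\<Sum>j<d. c j * X j l)" by (auto simp: lspan_def)
  then show "x \<in> lspan n e Y" by (intro lspan_lincomb[of "{..<d}" X n e Y x c] assms) auto
qed

text \<open>A vector depending on its predecessors is sent to \<open>0\<close>, because \<open>x / 0 = 0\<close>.\<close>

fun gram_schmidt :: "nat \<Rightarrow> (nat \<Rightarrow> nat \<Rightarrow> real) \<Rightarrow> nat \<Rightarrow> nat \<Rightarrow> real" where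
  "gram_schmidt n X j =
    (let v = (\<lambda>l. X j l - (\<Sum>i<j. rdot n (X j) (gram_schmidt n X i) * gram_schmidt n X i l))
     in (\<lambda>l. v l / rnorm n v))"

declare gram_schmidt.simps [simp del]

lemma gram_schmidt_eq:
  "gram_schmidt n X j = (\<lambda>l. residual n j (gram_schmidt n X) (X j) l /
     rnorm n (residual n j (gram_schmidt n X) (X j)))"
  by (subst gram_schmidt.simps) (simp add: residual_def Let_def)

lemma normalize_rdot:
  "rdot n (\<lambda>l. x l / rnorm n x) (\<lambda>l. x l / rnorm n x) = (if rdot n x x = 0 then 0 else 1)"
  by (simp add: rdot_divide_left rdot_commute[of n x "\<lambda>l. x l / _"] rnorm_def)

lemma gram_schmidt_orthosystem: "orthosystem n d (gram_schmidt n X)"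
proof (induction d)
  case (Suc d)
  have z: "rdot n (gram_schmidt n X d) (gram_schmidt n X i) = 0" if "i < d" for i
    using residual_orthogonal[OF Suc that] by (subst gram_schmidt_eq) (simp add: rdot_divide_left)
  moreover have "rdot n (gram_schmidt n X d) (gram_schmidt n X d) \<in> {0, 1}"
    unfolding gram_schmidt_eq[of n X d] normalize_rdot by simp
  moreover have "rdot n (gram_schmidt n X i) (gram_schmidt n X d) = 0" if "i < d" for i
    using z[OF that] by (simp add: rdot_commute)
  ultimately show ?case using Suc unfolding orthosystem_def
    by (auto simp: less_Suc_eq)
qed (simp add: orthosystem_def)

text \<open>Linear independence of the frame, phrased through Gram--Schmidt so that measurability
  follows from that of the coordinates.\<close>

definition nondeg :: "nat \<Rightarrow> nat \<Rightarrow> (nat \<Rightarrow> nat \<Rightarrow> real) \<Rightarrow> bool" where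
  "nondeg n k X \<longleftrightarrow> (\<forall>j<k. rdot n (gram_schmidt n X j) (gram_schmidt n X j) = 1)"

lemma nondeg_orthonormal: "nondeg n k X \<Longrightarrow> orthonormal n k (gram_schmidt n X)"
  using gram_schmidt_orthosystem[of n k X] by (auto simp: nondeg_def orthonormal_def orthosystem_def)

lemma gram_schmidt_residual:
  assumes "l < n"
  shows "residual n j (gram_schmidt n X) (X j) l =
    rnorm n (residual n j (gram_schmidt n X) (X j)) * gram_schmidt n X j l"
proof (cases "rnorm n (residual n j (gram_schmidt n X) (X j)) = 0")
  case True
  then have "residual n j (gram_schmidt n X) (X j) l = 0" using assms by (auto simp: rnorm_def rdot_self_eq_0)
  with True show ?thesis by simp
next
  case False
  then show ?thesis unfolding gram_schmidt_eq[of n X j] by simp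
qed

lemma lspan_gram_schmidt: "lspan n k X \<subseteq> lspan n k (gram_schmidt n X)"
proof (rule lspan_subset)
  fix j assume j: "j < k"
  let ?u = "gram_schmidt n X"
  define c where "c = (\<lambda>i. if i < j then rdot n (X j) (?u i) else rnorm n (residual n j ?u (X j)))"
  show "X j \<in> lspan n k ?u"
  proof (rule lspan_lincomb[of "{..j}" ?u])
    fix l assume l: "l < n"
    have "X j l = (\<Sum>i<j. rdot n (X j) (?u i) * ?u i l) + residual n j ?u (X j) l"
      by (simp add: residual_def)
    also have "\<dots> = (\<Sum>i<j. c i * ?u i l) + c j * ?u j l"
      unfolding gram_schmidt_residual[OF l] by (simp add: c_def)
    finally show "X j l = (\<Sum>i\<in>{..j}. c i * ?u i l)" by (simp add: lessThan_Suc_atMost[symmetric])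
  qed (use j in \<open>auto intro: lspan_base\<close>)
qed

lemma gram_schmidt_in_lspan: "j < k \<Longrightarrow> gram_schmidt n X j \<in> lspan n k X"
proof (induction j rule: less_induct)
  case (less j)
  let ?u = "gram_schmidt n X"
  define r where "r = rnorm n (residual n j ?u (X j))"
  define f where "f = (\<lambda>i. if i < j then ?u i else X j)"
  \<comment> \<open>For \<open>r = 0\<close> division by zero makes every coefficient 0, in
    agreement with the vanishing Gram--Schmidt vector, so no case distinction arises.\<close>
  define c where "c = (\<lambda>i. if i < j then - rdot n (X j) (?u i) / r else 1 / r)"
  show ?case
  proof (rule lspan_lincomb[of "{..j}" f])
    fix l assume l: "l < n"
    have "?u j l = (X j l - (\<Sum>i<j. rdot n (X j) (?u i) * ?u i l)) / r"
      by (subst gram_schmidt_eq) (simp add: residual_def r_def)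
    also have "\<dots> = (\<Sum>i\<le>j. c i * f i l)"
      by (simp add: c_def f_def lessThan_Suc_atMost[symmetric] diff_divide_distrib sum_negf sum_divide_distrib)
    finally show "?u j l = (\<Sum>i\<le>j. c i * f i l)" .
  qed (use less in \<open>auto simp: f_def intro: lspan_base\<close>)
qed

section \<open>Orthonormal bases and the restricted inner product\<close>

lemma is_onb_iff: "is_onb n k L u \<longleftrightarrow> orthonormal n k u \<and> L = lspan n k u"
  by (simp add: is_onb_def orthonormal_def)

lemma nondeg_is_onb: "nondeg n k X \<Longrightarrow> is_onb n k (lspan n k X) (gram_schmidt n X)"
  unfolding is_onb_iff
  by (intro conjI nondeg_orthonormal antisym lspan_gram_schmidt lspan_subset gram_schmidt_in_lspan)

text \<open>Comparing the Hilbert--Schmidt norm of the matrix of scalar products of two orthogonal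
  systems computed by rows and by columns replaces an appeal to dimension theory.\<close>

lemma not_nondeg_is_onb:
  assumes "\<not> nondeg n k X"
  shows "\<not> is_onb n k (lspan n k X) w"
proof
  assume w: "is_onb n k (lspan n k X) w"
  let ?u = "gram_schmidt n X"
  have won: "orthonormal n k w" using w by (simp add: is_onb_iff)
  have u: "orthosystem n k ?u" by (rule gram_schmidt_orthosystem)
  obtain i0 where i0: "i0 < k" "rdot n (?u i0) (?u i0) = 0"
    using assms u by (auto simp: nondeg_def orthosystem_def)
  have "w j \<in> lspan n k ?u" if "j < k" for j
    using lspan_base[OF that, of w n] w lspan_gram_schmidt[of n k X] by (auto simp: is_onb_iff)
  then have "(\<Sum>i<k. (rdot n (w j) (?u i))\<^sup>2) = 1" if "j < k" for j
    using lspan_parseval[OF u, of "w j"] won that by (simp add: orthonormal_def)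
  then have "real k = (\<Sum>j<k. \<Sum>i<k. (rdot n (w j) (?u i))\<^sup>2)" by simp
  also have "\<dots> = (\<Sum>i<k. \<Sum>j<k. (rdot n (?u i) (w j))\<^sup>2)"
    by (subst sum.swap) (simp add: rdot_commute)
  also have "\<dots> \<le> (\<Sum>i<k. rdot n (?u i) (?u i))"
    by (intro sum_mono bessel orthonormal_orthosystem won)
  also have "\<dots> = (\<Sum>i\<in>{..<k} - {i0}. rdot n (?u i) (?u i))"
    using i0 by (subst sum.remove[of _ i0]) auto
  also have "\<dots> \<le> (\<Sum>i\<in>{..<k} - {i0}. 1)"
  proof (rule sum_mono)
    fix i assume "i \<in> {..<k} - {i0}"
    then have "rdot n (?u i) (?u i) \<in> {0, 1}" using u by (auto simp: orthosystem_def)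
    then show "rdot n (?u i) (?u i) \<le> 1" by auto
  qed
  also have "\<dots> = real k - 1" using i0 by simp
  finally show False by simp
qed

text \<open>For orthonormal \<open>u\<close>, the scalar product of the orthogonal projections of
  \<open>a\<close> and \<open>b\<close> to the span of \<open>u\<close>.\<close>

definition proj_form :: "nat \<Rightarrow> nat \<Rightarrow> (nat \<Rightarrow> nat \<Rightarrow> real) \<Rightarrow> (nat \<Rightarrow> real) \<Rightarrow> (nat \<Rightarrow> real) \<Rightarrow> real" where
  "proj_form n k u a b = (\<Sum>t<k. rdot n a (u t) * rdot n b (u t))"

text \<open>Needed because \<open>sub_gip\<close> evaluates in a basis of which only
  \<open>is_onb\<close> is known. Expanding each \<open>u i\<close> in \<open>w\<close> on the side
  of \<open>a\<close> gives a double sum; read in the other order, it expands each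
  \<open>w j\<close> in \<open>u\<close> on the side of \<open>b\<close>.\<close>

lemma proj_form_onb:
  assumes "is_onb n k L u" "is_onb n k L w"
  shows "proj_form n k u a b = proj_form n k w a b"
proof -
  have u: "orthonormal n k u" and w: "orthonormal n k w" and L: "lspan n k u = lspan n k w"
    using assms by (auto simp: is_onb_iff)
  have 1: "rdot n a (u i) = (\<Sum>j<k. rdot n (u i) (w j) * rdot n a (w j))" if "i < k" for i
    using lspan_expand[OF w, of "u i" a] lspan_base[OF that, of u n] L by (simp add: rdot_commute[of n a])
  have 2: "rdot n b (w j) = (\<Sum>i<k. rdot n (u i) (w j) * rdot n b (u i))" if "j < k" for j
    using lspan_expand[OF u, of "w j" b] lspan_base[OF that, of w n] L
    by (simp add: rdot_commute[of n b] rdot_commute[of n _ "w j"] mult.commute)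
  have "proj_form n k u a b = (\<Sum>i<k. \<Sum>j<k. rdot n (u i) (w j) * rdot n a (w j) * rdot n b (u i))"
    unfolding proj_form_def using 1 by (simp add: sum_distrib_right)
  also have "\<dots> = (\<Sum>j<k. rdot n a (w j) * (\<Sum>i<k. rdot n (u i) (w j) * rdot n b (u i)))"
    by (subst sum.swap) (simp add: sum_distrib_left algebra_simps)
  also have "\<dots> = proj_form n k w a b"
    unfolding proj_form_def using 2 by simp
  finally show ?thesis .
qed

text \<open>Restriction replaces each coefficient vector by its coordinates in the basis, so the
  polynomial keeps its shape and \<open>gip_cpoly\<close> applies again in dimension
  \<open>k\<close>.\<close>

lemma cpoly_cemb: "cpoly n N m a \<alpha> (cemb k u w) = cpoly k N m (\<lambda>i j. rdot n (a i) (u j)) \<alpha> w"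
proof -
  have "(\<Sum>l<n. complex_of_real (a i l) * cemb k u w l) =
      (\<Sum>j<k. complex_of_real (rdot n (a i) (u j)) * w j)" for i
  proof -
    have "(\<Sum>l<n. complex_of_real (a i l) * cemb k u w l) =
       (\<Sum>l<n. \<Sum>j<k. complex_of_real (a i l * u j l) * w j)"
      by (simp add: cemb_def sum_distrib_left algebra_simps)
    also have "\<dots> = (\<Sum>j<k. complex_of_real (rdot n (a i) (u j)) * w j)"
      by (subst sum.swap) (simp add: rdot_def sum_distrib_right)
    finally show ?thesis .
  qed
  then show ?thesis by (simp add: cpoly_def)
qed

lemma sub_gip_onb:
  assumes "is_onb n k L u"
  shows "sub_gip n k L (cpoly n N m a \<alpha>) (cpoly n N m b \<beta>) =
     of_real (perm_form N m \<alpha> \<beta> (\<lambda>i j. proj_form n k u (a i) (b j)))"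
proof -
  define w where "w = (SOME u. is_onb n k L u)"
  have w: "is_onb n k L w" unfolding w_def using assms by (rule someI[of "is_onb n k L"])
  show ?thesis
    unfolding sub_gip_def Let_def w_def[symmetric] cpoly_cemb gip_cpoly
    unfolding proj_form_onb[OF assms w] by (simp add: rdot_def[of k] proj_form_def)
qed

text \<open>For linearly dependent \<open>X\<close> the choice in \<^const>\<open>sub_gip\<close> is from an empty predicate; the
  junk value does not depend on \<open>X\<close>, which keeps the event of the theorem measurable.\<close>

lemma sub_gip_degenerate:
  assumes "\<not> nondeg n k X"
  shows "sub_gip n k (lspan n k X) F G =
     gip k (\<lambda>w. F (cemb k (SOME u. False) w)) (\<lambda>w. G (cemb k (SOME u. False) w))"
  using not_nondeg_is_onb[OF assms] by (simp add: sub_gip_def Let_def)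

section \<open>Chi-square tails\<close>

lemma rgauss_eq: "rgauss = density lborel (\<lambda>x. ennreal (std_normal_density x))"
  by (simp add: rgauss_def std_normal_density_def)

lemma sets_rgauss [measurable_cong, simp]: "sets rgauss = sets borel"
  and space_rgauss [simp]: "space rgauss = UNIV"
  by (auto simp: rgauss_def)

lemma prob_space_rgauss: "prob_space rgauss"
  unfolding rgauss_eq by (rule prob_space_normal_density) simp

interpretation rgauss: prob_space rgauss
  by (rule prob_space_rgauss)

interpretation rgauss_prod: product_prob_space "\<lambda>_::nat. rgauss" UNIV ..

section \<open>Standard Gaussian vectors and their transforms\<close>

definition gvec :: "nat \<Rightarrow> (nat \<Rightarrow> real) measure" where
  "gvec n = PiM {..<n} (\<lambda>_. rgauss)"

lemma prob_space_gvec: "prob_space (gvec n)"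
  unfolding gvec_def by (intro prob_space_PiM prob_space_rgauss)

interpretation gvec: prob_space "gvec n" for n
  by (rule prob_space_gvec)

lemma sets_gvec [measurable_cong]: "sets (gvec n) = sets (PiM {..<n} (\<lambda>_. borel))"
  unfolding gvec_def by (intro sets_PiM_cong) auto

lemma rdot_measurable [measurable (raw)]:
  assumes "\<And>l. l < n \<Longrightarrow> (\<lambda>x. f x l) \<in> borel_measurable M" "\<And>l. l < n \<Longrightarrow> (\<lambda>x. g x l) \<in> borel_measurable M"
  shows "(\<lambda>x. rdot n (f x) (g x)) \<in> borel_measurable M"
  unfolding rdot_def using assms by (intro borel_measurable_sum borel_measurable_times) auto

lemma rdot_gvec [measurable]: "rdot n v \<in> borel_measurable (gvec n)"
  unfolding rdot_def by measurable

lemma rgauss_char: "(\<integral>x. iexp (t * x) \<partial>rgauss) = of_real (exp (- t\<^sup>2 / 2))"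
  using char_std_normal_distribution unfolding char_def rgauss_eq by (metis)

lemma rgauss_mgf: "(\<integral>\<^sup>+x. ennreal (exp (t * x)) \<partial>rgauss) = ennreal (exp (t\<^sup>2 / 2))"
proof -
  have "(\<integral>\<^sup>+x. ennreal (exp (t * x)) \<partial>rgauss) = (\<integral>\<^sup>+x. ennreal (exp (t\<^sup>2 / 2)) * ennreal (normal_density t 1 x) \<partial>lborel)"
    unfolding rgauss_eq
    by (subst nn_integral_density)
      (auto simp: ennreal_mult[symmetric] normal_density_def mult_exp_exp power2_eq_square field_simps
        intro!: nn_integral_cong)
  also have "\<dots> = ennreal (exp (t\<^sup>2 / 2))"
    by (simp add: nn_integral_cmult nn_integral_eq_integral)
  finally show ?thesis .
qed

text \<open>The weight turns the standard density into a multiple of the normal density of variance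
  1 / (1 - 2 * t), which exists exactly for \<open>t < 1 / 2\<close>.\<close>

lemma rgauss_square_mgf:
  assumes "t < 1 / 2"
  shows "(\<integral>\<^sup>+x. ennreal (exp (t * x\<^sup>2)) \<partial>rgauss) = ennreal (1 / sqrt (1 - 2 * t))"
proof -
  define r where "r = 1 - 2 * t"
  have r: "r > 0" "t = (1 - r) / 2" using assms by (auto simp: r_def)
  have "exp (t * x\<^sup>2) * std_normal_density x = (1 / sqrt r) * normal_density 0 (1 / sqrt r) x" for x
    using r(1) unfolding r(2) normal_density_def
    by (simp add: mult_exp_exp real_sqrt_mult real_sqrt_divide field_simps)
  then have "(\<integral>\<^sup>+x. ennreal (exp (t * x\<^sup>2)) \<partial>rgauss) =
      (\<integral>\<^sup>+x. ennreal (1 / sqrt r) * ennreal (normal_density 0 (1 / sqrt r) x) \<partial>lborel)"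
    unfolding rgauss_eq using r(1)
    by (subst nn_integral_density) (auto simp: ennreal_mult[symmetric] mult.commute intro!: nn_integral_cong)
  also have "\<dots> = ennreal (1 / sqrt r)"
    using r(1) by (simp add: nn_integral_cmult nn_integral_eq_integral)
  finally show ?thesis by (simp add: r_def)
qed

lemma gvec_char: "(\<integral>g. iexp (rdot n v g) \<partial>gvec n) = of_real (exp (- rdot n v v / 2))"
proof -
  have "(\<integral>g. iexp (rdot n v g) \<partial>gvec n) = (\<integral>g. (\<Prod>l<n. iexp (v l * g l)) \<partial>gvec n)"
    by (simp add: rdot_def exp_sum sum_distrib_left)
  also have "\<dots> = (\<Prod>l<n. \<integral>x. iexp (v l * x) \<partial>rgauss)"
    unfolding gvec_def
    by (rule rgauss_prod.product_integral_prod) (auto intro!: rgauss.integrable_const_bound[where B=1])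
  also have "\<dots> = of_real (exp (- rdot n v v / 2))"
    unfolding rgauss_char
    by (simp add: rdot_def exp_sum[symmetric] sum_negf sum_divide_distrib power2_eq_square
        flip: of_real_prod exp_of_real)
  finally show ?thesis .
qed

lemma gvec_mgf: "(\<integral>\<^sup>+g. ennreal (exp (rdot n v g)) \<partial>gvec n) = ennreal (exp (rdot n v v / 2))"
proof -
  have "(\<integral>\<^sup>+g. ennreal (exp (rdot n v g)) \<partial>gvec n) = (\<integral>\<^sup>+g. (\<Prod>l<n. ennreal (exp (v l * g l))) \<partial>gvec n)"
    by (simp add: rdot_def exp_sum prod_ennreal)
  also have "\<dots> = (\<Prod>l<n. \<integral>\<^sup>+x. ennreal (exp (v l * x)) \<partial>rgauss)"
    unfolding gvec_def by (rule rgauss_prod.product_nn_integral_prod) auto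
  also have "\<dots> = ennreal (exp (rdot n v v / 2))"
    by (simp add: rgauss_mgf rdot_def exp_sum[symmetric] prod_ennreal sum_divide_distrib power2_eq_square)
  finally show ?thesis .
qed

lemma gvec_square_mgf:
  assumes "t < 1 / 2"
  shows "(\<integral>\<^sup>+h. ennreal (exp (t * rdot d h h)) \<partial>gvec d) = ennreal ((1 / sqrt (1 - 2 * t)) ^ d)"
proof -
  have "(\<integral>\<^sup>+h. ennreal (exp (t * rdot d h h)) \<partial>gvec d) = (\<integral>\<^sup>+h. (\<Prod>l<d. ennreal (exp (t * (h l)\<^sup>2))) \<partial>gvec d)"
    by (simp add: rdot_def exp_sum prod_ennreal sum_distrib_left power2_eq_square)
  also have "\<dots> = (\<Prod>l<d. \<integral>\<^sup>+x. ennreal (exp (t * x\<^sup>2)) \<partial>rgauss)"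
    unfolding gvec_def by (rule rgauss_prod.product_nn_integral_prod) auto
  also have "\<dots> = ennreal ((1 / sqrt (1 - 2 * t)) ^ d)"
    unfolding rgauss_square_mgf[OF assms] prod_constant using assms by (simp add: ennreal_power del: ennreal_1 power_divide)
  finally show ?thesis .
qed

text \<open>One bilinear form in \<open>g\<close> and \<open>h\<close>, read as a linear form in
  either variable; this is what exchanging the two integrations in \<open>chi_square_mgf\<close>
  exploits.\<close>

lemma rdot_swap_lincomb:
  "rdot d (\<lambda>j. s * rdot n (u j) g) h = rdot n (\<lambda>l. \<Sum>j<d. (s * h j) * u j l) g"
  by (simp add: rdot_lincomb) (simp add: rdot_def algebra_simps)

lemma orthonormal_norm_lincomb:
  assumes "orthonormal n d u"
  shows "rdot n (\<lambda>l. \<Sum>j<d. (s * h j) * u j l) (\<lambda>l. \<Sum>j<d. (s * h j) * u j l) = s\<^sup>2 * rdot d h h"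
proof -
  have "rdot n (\<lambda>l. \<Sum>j<d. (s * h j) * u j l) (u i) = s * h i" if "i < d" for i
    using orthosystem_lincomb[OF orthonormal_orthosystem[OF assms] that, of "\<lambda>j. s * h j"] assms that
    by (simp add: orthonormal_def)
  then show ?thesis
    by (subst rdot_lincomb_right) (simp add: rdot_def sum_distrib_left power2_eq_square algebra_simps)
qed

lemma proj_form_eq_rdot: "s\<^sup>2 * proj_form n d u g g = rdot d (\<lambda>j. s * rdot n (u j) g) (\<lambda>j. s * rdot n (u j) g)"
  by (simp add: proj_form_def rdot_def[of d] rdot_commute[of n g] sum_distrib_left power2_eq_square algebra_simps)

lemma proj_form_measurable [measurable]: "(\<lambda>g. proj_form n d u g g) \<in> borel_measurable (gvec n)"
  unfolding proj_form_def rdot_commute[of n _ "u _"] by measurable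

text \<open>Linearising the quadratic form by a second, independent Gaussian vector \<open>h\<close> (with a real
  exponential for \<open>t \<ge> 0\<close> and a character for \<open>t \<le> 0\<close>) avoids rotating the coordinates.\<close>

lemma chi_square_mgf:
  assumes u: "orthonormal n d u" and t: "t < 1 / 2"
  shows "(\<integral>\<^sup>+g. ennreal (exp (t * proj_form n d u g g)) \<partial>gvec n) = ennreal ((1 / sqrt (1 - 2 * t)) ^ d)"
proof -
  interpret P: pair_prob_space "gvec n" "gvec d" ..
  have m [measurable]: "(\<lambda>z. rdot d (\<lambda>j. s * rdot n (u j) (fst z)) (snd z)) \<in> borel_measurable (gvec n \<Otimes>\<^sub>M gvec d)" for s
    unfolding rdot_def by measurable
  show ?thesis
  proof (cases "t \<ge> 0")
    case True
    \<comment> \<open>The Gaussian transform in \<open>h\<close> contributes the exponent s^2 / 2,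
      which must equal \<open>t\<close>.\<close>
    define s where "s = sqrt (2 * t)"
    have s: "s\<^sup>2 = 2 * t" using True by (simp add: s_def)
    have "(\<integral>\<^sup>+g. ennreal (exp (t * proj_form n d u g g)) \<partial>gvec n) =
       (\<integral>\<^sup>+g. \<integral>\<^sup>+h. ennreal (exp (rdot d (\<lambda>j. s * rdot n (u j) g) h)) \<partial>gvec d \<partial>gvec n)"
      unfolding gvec_mgf proj_form_eq_rdot[symmetric] s by simp
    also have "\<dots> = (\<integral>\<^sup>+h. \<integral>\<^sup>+g. ennreal (exp (rdot d (\<lambda>j. s * rdot n (u j) g) h)) \<partial>gvec n \<partial>gvec d)"
      by (rule P.Fubini'[symmetric]) (simp add: case_prod_beta)
    also have "\<dots> = (\<integral>\<^sup>+h. ennreal (exp (t * rdot d h h)) \<partial>gvec d)"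
      unfolding rdot_swap_lincomb gvec_mgf orthonormal_norm_lincomb[OF u] s by simp
    finally show ?thesis unfolding gvec_square_mgf[OF t] .
  next
    case False
    define s where "s = sqrt (- (2 * t))"
    have s: "s\<^sup>2 = - (2 * t)" using False by (simp add: s_def)
    have nonneg: "0 \<le> proj_form n d u g g" for g by (simp add: proj_form_def sum_nonneg)
    have bound: "exp (t * r) \<le> 1" if "r \<ge> 0" for r using False that by (simp add: mult_nonpos_nonneg)
    have int1: "integrable (gvec n) (\<lambda>g. exp (t * proj_form n d u g g))"
      using nonneg bound by (intro gvec.integrable_const_bound[where B=1]) auto
    have int2: "integrable (gvec d) (\<lambda>h. exp (t * rdot d h h))"
      using bound by (intro gvec.integrable_const_bound[where B=1]) auto
    have int3: "integrable (gvec n \<Otimes>\<^sub>M gvec d) (\<lambda>(g, h). iexp (rdot d (\<lambda>j. s * rdot n (u j) g) h))"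
      by (rule P.integrable_const_bound[where B=1]) (auto simp: case_prod_beta)
    have "complex_of_real (\<integral>g. exp (t * proj_form n d u g g) \<partial>gvec n) =
       (\<integral>g. \<integral>h. iexp (rdot d (\<lambda>j. s * rdot n (u j) g) h) \<partial>gvec d \<partial>gvec n)"
      unfolding gvec_char proj_form_eq_rdot[symmetric] s
      by (simp flip: integral_complex_of_real)
    also have "\<dots> = (\<integral>h. \<integral>g. iexp (rdot d (\<lambda>j. s * rdot n (u j) g) h) \<partial>gvec n \<partial>gvec d)"
      by (rule P.Fubini_integral[symmetric, OF int3])
    also have "\<dots> = complex_of_real (\<integral>h. exp (t * rdot d h h) \<partial>gvec d)"
      unfolding rdot_swap_lincomb gvec_char orthonormal_norm_lincomb[OF u] s
      by (simp flip: integral_complex_of_real)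
    finally have "(\<integral>g. exp (t * proj_form n d u g g) \<partial>gvec n) = (\<integral>h. exp (t * rdot d h h) \<partial>gvec d)"
      by (simp only: of_real_eq_iff)
    then have "(\<integral>\<^sup>+g. ennreal (exp (t * proj_form n d u g g)) \<partial>gvec n) = (\<integral>\<^sup>+h. ennreal (exp (t * rdot d h h)) \<partial>gvec d)"
      using int1 int2 by (simp add: nn_integral_eq_integral)
    then show ?thesis unfolding gvec_square_mgf[OF t] .
  qed
qed

text \<open>Keeping \<open>t\<close> on both sides of the inequality covers both tails: positive
  \<open>t\<close> gives the upper one and negative \<open>t\<close> the lower one.\<close>

lemma chi_square_chernoff:
  assumes u: "orthonormal n d u" and t: "t < 1 / 2"
  shows "emeasure (gvec n) {g \<in> space (gvec n). t * c \<le> t * proj_form n d u g g} \<le>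
    ennreal (exp (- t * c) * (1 / sqrt (1 - 2 * t)) ^ d)"
proof -
  have "emeasure (gvec n) {g \<in> space (gvec n). t * c \<le> t * proj_form n d u g g} =
     (\<integral>\<^sup>+g. indicator {g \<in> space (gvec n). t * c \<le> t * proj_form n d u g g} g \<partial>gvec n)"
    by (rule nn_integral_indicator[symmetric]) measurable
  also have "\<dots> \<le> (\<integral>\<^sup>+g. ennreal (exp (- t * c)) * ennreal (exp (t * proj_form n d u g g)) \<partial>gvec n)"
    by (intro nn_integral_mono)
      (auto simp: ennreal_mult[symmetric] mult_exp_exp split: split_indicator intro!: ennreal_leI simp flip: ennreal_1)
  also have "\<dots> = ennreal (exp (- t * c)) * ennreal ((1 / sqrt (1 - 2 * t)) ^ d)"
    by (subst nn_integral_cmult) (simp_all only: chi_square_mgf[OF u t], measurable)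
  finally show ?thesis using t by (simp add: ennreal_mult)
qed

lemma inverse_sqrt_power: "r > 0 \<Longrightarrow> (1 / sqrt r) ^ d = exp (- (real d * (ln r / 2)))"
proof -
  assume r: "r > 0"
  have "exp (- (ln r / 2)) = inverse (exp (ln (sqrt r)))" using r by (simp add: exp_minus ln_sqrt)
  also have "\<dots> = 1 / sqrt r" using r by (simp add: inverse_eq_divide)
  finally have "(1 / sqrt r) ^ d = exp (- (ln r / 2)) ^ d" by (rule arg_cong[OF sym])
  also have "\<dots> = exp (- (real d * (ln r / 2)))" by (simp only: exp_of_nat_mult[symmetric] mult_minus_right)
  finally show ?thesis .
qed

lemma chi_square_tails:
  assumes u: "orthonormal n d u" and \<eta>: "0 \<le> \<eta>" "\<eta> \<le> 1"
  shows chi_square_upper: "emeasure (gvec n) {g \<in> space (gvec n). (1 + \<eta>) * d \<le> proj_form n d u g g} \<le>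
      ennreal (exp (- (real d * \<eta>\<^sup>2 / 16)))"
    and chi_square_lower: "emeasure (gvec n) {g \<in> space (gvec n). proj_form n d u g g \<le> (1 - \<eta>) * d} \<le>
      ennreal (exp (- (real d * \<eta>\<^sup>2 / 16)))"
proof -
  show "emeasure (gvec n) {g \<in> space (gvec n). (1 + \<eta>) * d \<le> proj_form n d u g g} \<le>
      ennreal (exp (- (real d * \<eta>\<^sup>2 / 16)))"
  proof (cases "\<eta> = 0")
    case False
    \<comment> \<open>This minimises - t * \<eta> + 4 * t^2, the exponent per degree of freedom
      after the quadratic bound for the logarithm; the minimum is - \<eta>^2 / 16.\<close>
    define t where "t = \<eta> / 8"
    have t: "0 < t" "t < 1 / 2" using \<eta> False by (auto simp: t_def)
    have "{g \<in> space (gvec n). (1 + \<eta>) * d \<le> proj_form n d u g g} =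
       {g \<in> space (gvec n). t * ((1 + \<eta>) * d) \<le> t * proj_form n d u g g}" using t by simp
    also have "emeasure (gvec n) \<dots> \<le> ennreal (exp (- t * ((1 + \<eta>) * d)) * (1 / sqrt (1 - 2 * t)) ^ d)"
      by (rule chi_square_chernoff[OF u t(2)])
    also have "\<dots> \<le> ennreal (exp (- (real d * \<eta>\<^sup>2 / 16)))"
    proof (rule ennreal_leI)
      have "- (2 * t) - 2 * (2 * t)\<^sup>2 \<le> ln (1 - 2 * t)"
        using \<eta> by (intro ln_one_minus_pos_lower_bound) (auto simp: t_def)
      moreover have "- t * (1 + \<eta>) + t + (2 * t)\<^sup>2 = - \<eta>\<^sup>2 / 16"
        by (simp add: t_def power2_eq_square field_simps)
      ultimately have "- t * (1 + \<eta>) - ln (1 - 2 * t) / 2 \<le> - \<eta>\<^sup>2 / 16" by linarith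
      then have "real d * (- t * (1 + \<eta>) - ln (1 - 2 * t) / 2) \<le> real d * (- \<eta>\<^sup>2 / 16)"
        by (rule mult_left_mono) simp
      then show "exp (- t * ((1 + \<eta>) * d)) * (1 / sqrt (1 - 2 * t)) ^ d \<le> exp (- (real d * \<eta>\<^sup>2 / 16))"
        using t by (subst inverse_sqrt_power) (auto simp: mult_exp_exp algebra_simps)
    qed
    finally show ?thesis .
  qed (simp add: gvec.emeasure_le_1)
  show "emeasure (gvec n) {g \<in> space (gvec n). proj_form n d u g g \<le> (1 - \<eta>) * d} \<le>
      ennreal (exp (- (real d * \<eta>\<^sup>2 / 16)))"
  proof (cases "\<eta> = 0")
    case False
    \<comment> \<open>The bound for ln (1 + 2 * t) is sharper, so the exponent is - t * \<eta> + 2 *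
      t^2, with minimum - \<eta>^2 / 8 at this \<open>t\<close>. It is then weakened to the rate of
      the upper tail.\<close>
    define t where "t = \<eta> / 4"
    have t: "0 < t" "- t < 1 / 2" using \<eta> False by (auto simp: t_def)
    have "{g \<in> space (gvec n). proj_form n d u g g \<le> (1 - \<eta>) * d} =
       {g \<in> space (gvec n). - t * ((1 - \<eta>) * d) \<le> - t * proj_form n d u g g}" using t by simp
    also have "emeasure (gvec n) \<dots> \<le> ennreal (exp (- (- t) * ((1 - \<eta>) * d)) * (1 / sqrt (1 - 2 * - t)) ^ d)"
      by (rule chi_square_chernoff[OF u t(2)])
    also have "\<dots> \<le> ennreal (exp (- (real d * \<eta>\<^sup>2 / 16)))"
    proof (rule ennreal_leI)
      have "2 * t - (2 * t)\<^sup>2 \<le> ln (1 + 2 * t)"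
        using \<eta> by (intro ln_one_plus_pos_lower_bound) (auto simp: t_def)
      moreover have "t * (1 - \<eta>) - t + (2 * t)\<^sup>2 / 2 = - \<eta>\<^sup>2 / 8"
        by (simp add: t_def power2_eq_square field_simps)
      ultimately have "t * (1 - \<eta>) - ln (1 + 2 * t) / 2 \<le> - \<eta>\<^sup>2 / 8" by linarith
      also have "\<dots> \<le> - \<eta>\<^sup>2 / 16" by simp
      finally have "real d * (t * (1 - \<eta>) - ln (1 + 2 * t) / 2) \<le> real d * (- \<eta>\<^sup>2 / 16)"
        by (rule mult_left_mono) simp
      then show "exp (- (- t) * ((1 - \<eta>) * d)) * (1 / sqrt (1 - 2 * - t)) ^ d \<le> exp (- (real d * \<eta>\<^sup>2 / 16))"
        using t by (subst inverse_sqrt_power) (auto simp: mult_exp_exp algebra_simps)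
    qed
    finally show ?thesis .
  qed (simp add: gvec.emeasure_le_1)
qed

text \<open>The normalised form is a one-dimensional orthonormal system, and the hyperplane is its
  lower tail at level 0. The Chernoff bound 1 / sqrt (1 + 2 * s) tends to 0 as \<open>s\<close>
  grows.\<close>

lemma gvec_hyperplane_null:
  assumes "rdot n y y \<noteq> 0"
  shows "emeasure (gvec n) {g \<in> space (gvec n). rdot n y g = 0} = 0"
proof -
  let ?u = "\<lambda>_::nat. (\<lambda>l. y l / rnorm n y)"
  have u: "orthonormal n 1 ?u" using assms by (simp add: orthonormal_def normalize_rdot)
  have set_eq: "{g \<in> space (gvec n). rdot n y g = 0} = {g \<in> space (gvec n). - s * 0 \<le> - s * proj_form n 1 ?u g g}"
    if "s > 0" for s
  proof -
    have "proj_form n 1 ?u g g = (rdot n y g / rnorm n y)\<^sup>2" for g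
      by (simp add: proj_form_def rdot_commute[of n g] rdot_divide_left power2_eq_square)
    moreover have "rnorm n y \<noteq> 0" using assms by (simp add: rnorm_def)
    moreover have "- s * 0 \<le> - s * q\<^sup>2 \<longleftrightarrow> q = 0" for q :: real
      using that by (simp add: mult_le_0_iff)
    ultimately show ?thesis by simp
  qed
  have "emeasure (gvec n) {g \<in> space (gvec n). rdot n y g = 0} \<le> 0 + ennreal e" if "e > 0" for e
  proof -
    \<comment> \<open>Then 2 * s = 1 / e^2, so the Chernoff bound 1 / sqrt (1 + 2 * s) is at most
      \<open>e\<close>.\<close>
    define s where "s = 1 / (2 * e\<^sup>2)"
    have s: "s > 0" using that by (simp add: s_def)
    have "emeasure (gvec n) {g \<in> space (gvec n). rdot n y g = 0} \<le>
        ennreal (exp (- (- s) * 0) * (1 / sqrt (1 - 2 * - s)) ^ 1)"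
      unfolding set_eq[OF s] using s by (intro chi_square_chernoff u) auto
    also have "\<dots> \<le> ennreal e"
    proof (rule ennreal_leI)
      have "1 / e \<le> sqrt (1 + 2 * s)" using that
        by (intro real_le_rsqrt) (simp add: s_def power_divide)
      then show "exp (- (- s) * 0) * (1 / sqrt (1 - 2 * - s)) ^ 1 \<le> e"
        using that s by (simp add: field_simps add_pos_pos)
    qed
    finally show ?thesis by simp
  qed
  then show ?thesis using ennreal_le_epsilon[of 0 "emeasure (gvec n) {g \<in> space (gvec n). rdot n y g = 0}"] by auto
qed

section \<open>Rotation invariance\<close>

text \<open>For nonzero \<open>c\<close> the rotation splits into two one-dimensional affine
  substitutions, one in each variable, with scaling factors 1 / c and \<open>c\<close> that
  cancel.\<close>

lemma lborel_rotation_nn_integral: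
  fixes c s :: real
  assumes cs: "c\<^sup>2 + s\<^sup>2 = 1" and H [measurable]: "case_prod H \<in> borel_measurable (borel \<Otimes>\<^sub>M borel)"
  shows "(\<integral>\<^sup>+x. \<integral>\<^sup>+y. H (c * x + s * y) (c * y - s * x) \<partial>lborel \<partial>lborel) = (\<integral>\<^sup>+x. \<integral>\<^sup>+y. H x y \<partial>lborel \<partial>lborel)"
proof (cases "c = 0")
  case False
  have m [measurable]: "(\<lambda>x. H (f x) (g x)) \<in> borel_measurable M"
    if [measurable]: "f \<in> borel_measurable M" "g \<in> borel_measurable M" for f g and M :: "'z measure"
    using measurable_compose[OF _ H, of "\<lambda>x. (f x, g x)" M] by simp
  have "(\<integral>\<^sup>+x. \<integral>\<^sup>+y. H (c * x + s * y) (c * y - s * x) \<partial>lborel \<partial>lborel) =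
     (\<integral>\<^sup>+y. \<integral>\<^sup>+x. H (c * x + s * y) (c * y - s * x) \<partial>lborel \<partial>lborel)"
    by (rule lborel_pair.Fubini') simp
  \<comment> \<open>The substitution makes the first argument of \<open>H\<close> the new variable;
    the second becomes (y - s * x) / c because of \<open>cs\<close>.\<close>
  also have "\<dots> = (\<integral>\<^sup>+y. ennreal \<bar>1 / c\<bar> * (\<integral>\<^sup>+x. H x ((y - s * x) / c) \<partial>lborel) \<partial>lborel)"
  proof (rule nn_integral_cong)
    fix y
    have "c * (- s * y / c + 1 / c * x) + s * y = x" for x
      using False by (simp add: field_simps)
    moreover have "c * y - s * (- s * y / c + 1 / c * x) = (y - s * x) / c" for x
    proof -
      have "c * y - s * (- s * y / c + 1 / c * x) = ((c\<^sup>2 + s\<^sup>2) * y - s * x) / c"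
        using False by (simp add: field_simps power2_eq_square)
      then show ?thesis by (simp add: cs)
    qed
    ultimately show "(\<integral>\<^sup>+x. H (c * x + s * y) (c * y - s * x) \<partial>lborel) = ennreal \<bar>1 / c\<bar> * (\<integral>\<^sup>+x. H x ((y - s * x) / c) \<partial>lborel)"
      using False by (subst nn_integral_real_affine[of _ "1 / c" "- s * y / c"]) auto
  qed
  also have "\<dots> = ennreal \<bar>1 / c\<bar> * (\<integral>\<^sup>+y. \<integral>\<^sup>+x. H x ((y - s * x) / c) \<partial>lborel \<partial>lborel)"
    by (rule nn_integral_cmult) measurable
  also have "(\<integral>\<^sup>+y. \<integral>\<^sup>+x. H x ((y - s * x) / c) \<partial>lborel \<partial>lborel) = (\<integral>\<^sup>+x. \<integral>\<^sup>+y. H x ((y - s * x) / c) \<partial>lborel \<partial>lborel)"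
    by (rule lborel_pair.Fubini'[symmetric]) simp
  also have "\<dots> = (\<integral>\<^sup>+x. ennreal \<bar>c\<bar> * (\<integral>\<^sup>+y. H x y \<partial>lborel) \<partial>lborel)"
  proof (rule nn_integral_cong)
    fix x
    show "(\<integral>\<^sup>+y. H x ((y - s * x) / c) \<partial>lborel) = ennreal \<bar>c\<bar> * (\<integral>\<^sup>+y. H x y \<partial>lborel)"
      using False by (subst nn_integral_real_affine[of _ c "s * x"]) auto
  qed
  also have "\<dots> = ennreal \<bar>c\<bar> * (\<integral>\<^sup>+x. \<integral>\<^sup>+y. H x y \<partial>lborel \<partial>lborel)"
    by (rule nn_integral_cmult) measurable
  finally show ?thesis
    using False by (simp add: mult.assoc[symmetric] ennreal_mult[symmetric])
next
  case True
  have m [measurable]: "(\<lambda>x. H (f x) (g x)) \<in> borel_measurable M"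
    if [measurable]: "f \<in> borel_measurable M" "g \<in> borel_measurable M" for f g and M :: "'z measure"
    using measurable_compose[OF _ H, of "\<lambda>x. (f x, g x)" M] by simp
  \<comment> \<open>A quarter turn: exchange of the two variables combined with a reflection of one
    of them.\<close>
  have s: "s = 1 \<or> s = - 1" using cs True by (simp add: power2_eq_1_iff)
  have refl: "(\<integral>\<^sup>+x. f (- x) \<partial>lborel) = (\<integral>\<^sup>+x. f x \<partial>lborel)"
    if "f \<in> borel_measurable borel" for f :: "real \<Rightarrow> ennreal"
    using nn_integral_real_affine[of f "- 1" 0] that by simp
  have eq1: "(\<integral>\<^sup>+y. H (s * y) (- (s * x)) \<partial>lborel) = (\<integral>\<^sup>+y. H y (- (s * x)) \<partial>lborel)" for x
    using s refl[of "\<lambda>y. H y (- (s * x))"] by auto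
  have eq2: "(\<integral>\<^sup>+x. H y (- (s * x)) \<partial>lborel) = (\<integral>\<^sup>+x. H y x \<partial>lborel)" for y
    using s refl[of "\<lambda>x. H y x"] by auto
  have "(\<integral>\<^sup>+x. \<integral>\<^sup>+y. H (s * y) (- (s * x)) \<partial>lborel \<partial>lborel) = (\<integral>\<^sup>+x. \<integral>\<^sup>+y. H y (- (s * x)) \<partial>lborel \<partial>lborel)"
    by (simp only: eq1)
  also have "\<dots> = (\<integral>\<^sup>+y. \<integral>\<^sup>+x. H y (- (s * x)) \<partial>lborel \<partial>lborel)"
    by (rule lborel_pair.Fubini') simp
  also have "\<dots> = (\<integral>\<^sup>+y. \<integral>\<^sup>+x. H y x \<partial>lborel \<partial>lborel)"
    by (simp only: eq2)
  finally show ?thesis using True by simp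
qed

lemma rgauss_rotation_nn_integral:
  fixes c s :: real
  assumes cs: "c\<^sup>2 + s\<^sup>2 = 1" and h [measurable]: "case_prod h \<in> borel_measurable (borel \<Otimes>\<^sub>M borel)"
  shows "(\<integral>\<^sup>+x. \<integral>\<^sup>+y. h (c * x + s * y) (c * y - s * x) \<partial>rgauss \<partial>rgauss) = (\<integral>\<^sup>+x. \<integral>\<^sup>+y. h x y \<partial>rgauss \<partial>rgauss)"
proof -
  define H where "H = (\<lambda>x y. ennreal (std_normal_density x * std_normal_density y) * h x y)"
  have hm [measurable]: "(\<lambda>x. h (f x) (g x)) \<in> borel_measurable M"
    if [measurable]: "f \<in> borel_measurable M" "g \<in> borel_measurable M" for f g and M :: "'z measure"
    using measurable_compose[OF _ h, of "\<lambda>x. (f x, g x)" M] by simp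
  have dens: "(\<integral>\<^sup>+x. \<integral>\<^sup>+y. f x y \<partial>rgauss \<partial>rgauss) =
      (\<integral>\<^sup>+x. \<integral>\<^sup>+y. ennreal (std_normal_density x * std_normal_density y) * f x y \<partial>lborel \<partial>lborel)"
    if that: "case_prod f \<in> borel_measurable (borel \<Otimes>\<^sub>M borel)" for f :: "real \<Rightarrow> real \<Rightarrow> ennreal"
  proof -
    have fm [measurable]: "f x \<in> borel_measurable borel" for x
      using measurable_Pair2[OF that, of x] by simp
    have dens1: "(\<integral>\<^sup>+x. g x \<partial>rgauss) = (\<integral>\<^sup>+x. ennreal (std_normal_density x) * g x \<partial>lborel)"
      if "g \<in> borel_measurable borel" for g
      unfolding rgauss_eq by (rule nn_integral_density) (use that in auto)
    have "(\<lambda>x. \<integral>\<^sup>+y. f x y \<partial>rgauss) \<in> borel_measurable borel"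
      by (rule rgauss.borel_measurable_nn_integral) (use that in simp)
    then have "(\<integral>\<^sup>+x. \<integral>\<^sup>+y. f x y \<partial>rgauss \<partial>rgauss) =
       (\<integral>\<^sup>+x. ennreal (std_normal_density x) * (\<integral>\<^sup>+y. ennreal (std_normal_density y) * f x y \<partial>lborel) \<partial>lborel)"
      using dens1[of "\<lambda>x. \<integral>\<^sup>+y. f x y \<partial>rgauss"] dens1[OF fm] by simp
    also have "\<dots> = (\<integral>\<^sup>+x. \<integral>\<^sup>+y. ennreal (std_normal_density x * std_normal_density y) * f x y \<partial>lborel \<partial>lborel)"
      by (simp add: nn_integral_cmult[symmetric] ennreal_mult mult.assoc)
    finally show ?thesis .
  qed
  have "std_normal_density (c * x + s * y) * std_normal_density (c * y - s * x) =
     std_normal_density x * std_normal_density y" for x y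
  proof -
    have "(c * x + s * y)\<^sup>2 + (c * y - s * x)\<^sup>2 = (c\<^sup>2 + s\<^sup>2) * (x\<^sup>2 + y\<^sup>2)"
      by (simp add: power2_eq_square algebra_simps)
    then have "- (c * x + s * y)\<^sup>2 / 2 + - (c * y - s * x)\<^sup>2 / 2 = - x\<^sup>2 / 2 + - y\<^sup>2 / 2"
      by (simp add: cs field_simps)
    then have "exp (- (c * x + s * y)\<^sup>2 / 2) * exp (- (c * y - s * x)\<^sup>2 / 2) = exp (- x\<^sup>2 / 2) * exp (- y\<^sup>2 / 2)"
      by (simp only: mult_exp_exp)
    then show ?thesis by (simp add: std_normal_density_def)
  qed
  then have eq: "ennreal (std_normal_density x * std_normal_density y) * h (c * x + s * y) (c * y - s * x) =
      H (c * x + s * y) (c * y - s * x)" for x y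
    by (simp add: H_def)
  have "(\<integral>\<^sup>+x. \<integral>\<^sup>+y. h (c * x + s * y) (c * y - s * x) \<partial>rgauss \<partial>rgauss) =
     (\<integral>\<^sup>+x. \<integral>\<^sup>+y. H (c * x + s * y) (c * y - s * x) \<partial>lborel \<partial>lborel)"
    by (subst dens) (auto simp: eq)
  also have "\<dots> = (\<integral>\<^sup>+x. \<integral>\<^sup>+y. H x y \<partial>lborel \<partial>lborel)"
    by (rule lborel_rotation_nn_integral[OF cs]) (unfold H_def, measurable)
  also have "\<dots> = (\<integral>\<^sup>+x. \<integral>\<^sup>+y. h x y \<partial>rgauss \<partial>rgauss)"
    by (subst dens) (auto simp: H_def)
  finally show ?thesis .
qed

text \<open>Both updated entries use the old values, so this is a rotation of the plane of
  coordinates \<open>p\<close> and \<open>q\<close> when c^2 + s^2 = 1.\<close>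

definition givens :: "nat \<Rightarrow> nat \<Rightarrow> real \<Rightarrow> real \<Rightarrow> (nat \<Rightarrow> real) \<Rightarrow> nat \<Rightarrow> real" where
  "givens p q c s x = x(p := c * x p + s * x q, q := c * x q - s * x p)"

context
  fixes n p q :: nat and c s :: real
  assumes pq: "p < n" "q < n" "p \<noteq> q" and cs: "c\<^sup>2 + s\<^sup>2 = 1"
begin

lemma rdot_givens: "rdot n (givens p q c s x) (givens p q c s y) = rdot n x y"
proof -
  have split: "rdot n x y = x p * y p + (x q * y q + (\<Sum>l\<in>{..<n}-{p}-{q}. x l * y l))" for x y
    unfolding rdot_def using pq by (subst sum.remove[of _ p], simp, simp, subst sum.remove[of _ q]) auto
  have "(c * x p + s * x q) * (c * y p + s * y q) + (c * x q - s * x p) * (c * y q - s * y p) =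
      (c\<^sup>2 + s\<^sup>2) * (x p * y p + x q * y q)" by (simp add: power2_eq_square algebra_simps)
  moreover have "(\<Sum>l\<in>{..<n}-{p}-{q}. givens p q c s x l * givens p q c s y l) = (\<Sum>l\<in>{..<n}-{p}-{q}. x l * y l)"
    by (intro sum.cong) (auto simp: givens_def)
  ultimately show ?thesis unfolding split using pq by (simp add: givens_def cs)
qed

lemma givens_measurable [measurable]: "givens p q c s \<in> measurable (gvec n) (gvec n)"
proof -
  have "(\<lambda>x. (x(p := c * x p + s * x q))(q := c * x q - s * x p)) \<in> measurable (gvec n) (PiM {..<n} (\<lambda>_. rgauss))"
    unfolding gvec_def using pq
    by (intro measurable_fun_upd[where J="{..<n}"]) (auto intro!: borel_measurable_add borel_measurable_diff borel_measurable_times)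
  then show ?thesis by (simp add: givens_def[abs_def] gvec_def)
qed

text \<open>Integrate the other coordinates last. For fixed values of them, the double integral over
  coordinates \<open>p\<close> and \<open>q\<close> is invariant by the two-dimensional
  case.\<close>

lemma gvec_givens: "distr (gvec n) (gvec n) (givens p q c s) = gvec n"
proof (rule measure_eqI)
  fix A assume "A \<in> sets (distr (gvec n) (gvec n) (givens p q c s))"
  then have A [measurable]: "A \<in> sets (gvec n)" by simp
  define R where "R = {..<n} - {p, q}"
  have R: "{..<n} = insert p (insert q R)" "finite R" "q \<notin> R" "p \<notin> insert q R"
    using pq by (auto simp: R_def)
  have upd [measurable]: "(\<lambda>z. x(q := snd z, p := fst z)) \<in> measurable (borel \<Otimes>\<^sub>M borel) (gvec n)"
    if x: "x \<in> space (PiM R (\<lambda>_. rgauss))" for x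
  proof -
    have "(\<lambda>z. x(q := snd z)) \<in> measurable (borel \<Otimes>\<^sub>M borel) (PiM (insert q R) (\<lambda>_. rgauss))"
      by (rule measurable_fun_upd[where J=R]) (use x in simp_all)
    then have "(\<lambda>z. (x(q := snd z))(p := fst z)) \<in> measurable (borel \<Otimes>\<^sub>M borel) (PiM (insert p (insert q R)) (\<lambda>_. rgauss))"
      by (rule measurable_fun_upd[where J="insert q R", rotated]) simp_all
    then show ?thesis by (simp add: gvec_def R(1))
  qed
  have iter: "(\<integral>\<^sup>+x. f x \<partial>gvec n) = (\<integral>\<^sup>+x. \<integral>\<^sup>+z. \<integral>\<^sup>+y. f (x(q := z, p := y)) \<partial>rgauss \<partial>rgauss \<partial>PiM R (\<lambda>_. rgauss))"
    if f: "f \<in> borel_measurable (gvec n)" for f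
  proof -
    have f' [measurable]: "f \<in> borel_measurable (PiM (insert p (insert q R)) (\<lambda>_. rgauss))"
      using f unfolding gvec_def R(1) .
    have [measurable]: "(\<lambda>x. \<integral>\<^sup>+y. f (x(p := y)) \<partial>rgauss) \<in> borel_measurable (PiM (insert q R) (\<lambda>_. rgauss))"
    proof (rule rgauss.borel_measurable_nn_integral)
      have "(\<lambda>z. f ((fst z)(p := snd z))) \<in> borel_measurable (PiM (insert q R) (\<lambda>_. rgauss) \<Otimes>\<^sub>M rgauss)"
        by (rule measurable_compose[OF _ f'], rule measurable_fun_upd[where J="insert q R"]) auto
      then show "(\<lambda>(x, y). f (x(p := y))) \<in> borel_measurable (PiM (insert q R) (\<lambda>_. rgauss) \<Otimes>\<^sub>M rgauss)"
        by (simp add: case_prod_beta)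
    qed
    have "(\<integral>\<^sup>+x. f x \<partial>gvec n) = (\<integral>\<^sup>+x. \<integral>\<^sup>+y. f (x(p := y)) \<partial>rgauss \<partial>PiM (insert q R) (\<lambda>_. rgauss))"
      unfolding gvec_def R(1) using R by (intro rgauss_prod.product_nn_integral_insert) auto
    also have "\<dots> = (\<integral>\<^sup>+x. \<integral>\<^sup>+z. \<integral>\<^sup>+y. f (x(q := z, p := y)) \<partial>rgauss \<partial>rgauss \<partial>PiM R (\<lambda>_. rgauss))"
      using R by (subst rgauss_prod.product_nn_integral_insert) auto
    finally show ?thesis .
  qed
  interpret P: pair_sigma_finite rgauss rgauss ..
  have "emeasure (distr (gvec n) (gvec n) (givens p q c s)) A = (\<integral>\<^sup>+x. indicator A x \<partial>distr (gvec n) (gvec n) (givens p q c s))"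
    by simp
  also have "\<dots> = (\<integral>\<^sup>+x. indicator A (givens p q c s x) \<partial>gvec n)"
    by (rule nn_integral_distr) auto
  also have "\<dots> = (\<integral>\<^sup>+x. \<integral>\<^sup>+z. \<integral>\<^sup>+y. indicator A (givens p q c s (x(q := z, p := y))) \<partial>rgauss \<partial>rgauss \<partial>PiM R (\<lambda>_. rgauss))"
    by (rule iter) measurable
  also have "\<dots> = (\<integral>\<^sup>+x. \<integral>\<^sup>+z. \<integral>\<^sup>+y. indicator A (x(q := z, p := y)) \<partial>rgauss \<partial>rgauss \<partial>PiM R (\<lambda>_. rgauss))"
  proof (rule nn_integral_cong)
    fix x assume x: "x \<in> space (PiM R (\<lambda>_. rgauss))"
    define h where "h = (\<lambda>y z. indicator A (x(q := z, p := y)) :: ennreal)"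
    have hm: "(\<lambda>z. h (fst z) (snd z)) \<in> borel_measurable (borel \<Otimes>\<^sub>M borel)"
      unfolding h_def by (rule measurable_compose[OF upd[OF x]]) measurable
    then have hm' [measurable]: "case_prod h \<in> borel_measurable (borel \<Otimes>\<^sub>M borel)" by (simp add: case_prod_beta')
    have hc [measurable]: "(\<lambda>x. h (f x) (g x)) \<in> borel_measurable M"
      if [measurable]: "f \<in> borel_measurable M" "g \<in> borel_measurable M" for f g and M :: "'z measure"
      using measurable_compose[OF _ hm', of "\<lambda>x. (f x, g x)" M] by simp
    have "(\<integral>\<^sup>+z. \<integral>\<^sup>+y. indicator A (givens p q c s (x(q := z, p := y))) \<partial>rgauss \<partial>rgauss) =
        (\<integral>\<^sup>+z. \<integral>\<^sup>+y. h (c * y + s * z) (c * z - s * y) \<partial>rgauss \<partial>rgauss)"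
    proof (intro nn_integral_cong)
      fix y z
      have "givens p q c s (x(q := z, p := y)) = x(q := c * z - s * y, p := c * y + s * z)"
        using pq(3) by (auto simp: givens_def fun_eq_iff)
      then show "indicator A (givens p q c s (x(q := z, p := y))) = h (c * y + s * z) (c * z - s * y)"
        by (simp add: h_def)
    qed
    also have "\<dots> = (\<integral>\<^sup>+y. \<integral>\<^sup>+z. h (c * y + s * z) (c * z - s * y) \<partial>rgauss \<partial>rgauss)"
      by (rule P.Fubini') measurable
    also have "\<dots> = (\<integral>\<^sup>+y. \<integral>\<^sup>+z. h y z \<partial>rgauss \<partial>rgauss)"
      by (rule rgauss_rotation_nn_integral[OF cs hm'])
    also have "\<dots> = (\<integral>\<^sup>+z. \<integral>\<^sup>+y. h y z \<partial>rgauss \<partial>rgauss)"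
      by (rule P.Fubini'[symmetric]) measurable
    finally show "(\<integral>\<^sup>+z. \<integral>\<^sup>+y. indicator A (givens p q c s (x(q := z, p := y))) \<partial>rgauss \<partial>rgauss) =
        (\<integral>\<^sup>+z. \<integral>\<^sup>+y. indicator A (x(q := z, p := y)) \<partial>rgauss \<partial>rgauss)"
      unfolding h_def .
  qed
  also have "\<dots> = (\<integral>\<^sup>+x. indicator A x \<partial>gvec n)"
    by (rule iter[symmetric]) measurable
  also have "\<dots> = emeasure (gvec n) A" by simp
  finally show "emeasure (distr (gvec n) (gvec n) (givens p q c s)) A = emeasure (gvec n) A" .
qed simp

text \<open>The same rotation acts on every vector of the frame; \<open>compose {..<k}\<close> keeps
  the result extensional, as points of a product space must be.\<close>

lemma gauss_frames_givens:
  "distr (gauss_frames n k) (gauss_frames n k) (compose {..<k} (givens p q c s)) = gauss_frames n k"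
  unfolding gauss_frames_def gvec_def[symmetric]
  by (subst distr_PiM_finite_prob_space') (auto intro: prob_space_gvec simp: gvec_givens)

lemma givens_residual:
  "givens p q c s (\<lambda>l. x l - (\<Sum>i\<in>A. e i * u i l)) =
    (\<lambda>l. givens p q c s x l - (\<Sum>i\<in>A. e i * givens p q c s (u i) l))"
proof
  fix l
  have "(\<Sum>i\<in>A. e i * (a * u i p + b * u i q)) = a * (\<Sum>i\<in>A. e i * u i p) + b * (\<Sum>i\<in>A. e i * u i q)" for a b
    by (simp add: algebra_simps sum.distrib sum_distrib_left)
  from this[of c s] this[of "- s" c] show "givens p q c s (\<lambda>l. x l - (\<Sum>i\<in>A. e i * u i l)) l =
     givens p q c s x l - (\<Sum>i\<in>A. e i * givens p q c s (u i) l)"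
    by (simp add: givens_def algebra_simps)
qed

text \<open>Gram--Schmidt consists of linear combinations, which commute with the rotation, and of
  scalar products, which it preserves.\<close>

lemma gram_schmidt_givens:
  assumes "\<And>j. j < k \<Longrightarrow> Y j = givens p q c s (X j)" "j < k"
  shows "gram_schmidt n Y j = givens p q c s (gram_schmidt n X j)"
  using assms(2)
proof (induction j rule: less_induct)
  case (less j)
  let ?T = "givens p q c s"
  have "residual n j (gram_schmidt n Y) (Y j) = ?T (residual n j (gram_schmidt n X) (X j))"
    unfolding residual_def givens_residual
    using less by (intro ext) (simp add: assms(1) rdot_givens)
  moreover have "?T (\<lambda>l. v l / r) = (\<lambda>l. ?T v l / r)" for v r
    by (auto simp: givens_def fun_eq_iff add_divide_distrib diff_divide_distrib)
  ultimately show ?case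
    unfolding gram_schmidt_eq[of n _ j] by (simp add: rnorm_def rdot_givens)
qed

end

section \<open>Random projection of a fixed vector\<close>

lemma gram_schmidt_cong: "(\<And>i. i \<le> j \<Longrightarrow> X i = Y i) \<Longrightarrow> gram_schmidt n X j = gram_schmidt n Y j"
proof (induction j rule: less_induct)
  case (less j)
  have "residual n j (gram_schmidt n X) (X j) = residual n j (gram_schmidt n Y) (Y j)"
    unfolding residual_def using less by simp
  then show ?case by (simp add: gram_schmidt_eq[of n _ j])
qed

lemma gauss_frames_gvec: "gauss_frames n k = PiM {..<k} (\<lambda>_. gvec n)"
  by (simp add: gauss_frames_def gvec_def)

lemma prob_space_gauss_frames: "prob_space (gauss_frames n k)"
  unfolding gauss_frames_gvec by (intro prob_space_PiM prob_space_gvec)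

interpretation gauss_frames: prob_space "gauss_frames n k" for n k
  by (rule prob_space_gauss_frames)

interpretation frames_prod: product_prob_space "\<lambda>_::nat. gvec n" UNIV for n ..

lemma gauss_frames_coord:
  "j < k \<Longrightarrow> l < n \<Longrightarrow> (\<lambda>X. X j l) \<in> borel_measurable (gauss_frames n k)"
proof -
  assume "j < k" "l < n"
  then have "(\<lambda>X. X j) \<in> measurable (gauss_frames n k) (gvec n)" "(\<lambda>x. x l) \<in> measurable (gvec n) rgauss"
    unfolding gauss_frames_gvec by (auto intro: measurable_component_singleton simp: gvec_def)
  from measurable_compose[OF this] show ?thesis by (simp cong: measurable_cong_sets)
qed

lemma gvec_coord: "l < n \<Longrightarrow> (\<lambda>x. x l) \<in> borel_measurable (gvec n)"
  using measurable_component_singleton[of l "{..<n}" "\<lambda>_. rgauss"] by (simp add: gvec_def)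

lemma gram_schmidt_measurable:
  "j < k \<Longrightarrow> l < n \<Longrightarrow> (\<lambda>X. gram_schmidt n X j l) \<in> borel_measurable (gauss_frames n k)"
proof (induction j arbitrary: l rule: less_induct)
  case (less j)
  have [measurable]: "(\<lambda>X. rdot n (X j) (gram_schmidt n X i)) \<in> borel_measurable (gauss_frames n k)" if "i < j" for i
    using less that by (intro rdot_measurable gauss_frames_coord) auto
  have r: "(\<lambda>X. residual n j (gram_schmidt n X) (X j) l) \<in> borel_measurable (gauss_frames n k)" if "l < n" for l
    unfolding residual_def using less that
    by (intro borel_measurable_diff borel_measurable_sum borel_measurable_times gauss_frames_coord) auto
  have "(\<lambda>X. rnorm n (residual n j (gram_schmidt n X) (X j))) \<in> borel_measurable (gauss_frames n k)"
    unfolding rnorm_def using r by (intro measurable_compose[OF _ borel_measurable_sqrt] rdot_measurable) auto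
  then show ?case unfolding gram_schmidt_eq[of n _ j]
    using r less.prems by (intro borel_measurable_divide) auto
qed

lemma proj_form_frames_measurable:
  assumes "\<And>l. l < n \<Longrightarrow> (\<lambda>z. a z l) \<in> borel_measurable M" "\<And>l. l < n \<Longrightarrow> (\<lambda>z. b z l) \<in> borel_measurable M"
    and X: "X \<in> measurable M (gauss_frames n k)"
  shows "(\<lambda>z. proj_form n k (gram_schmidt n (X z)) (a z) (b z)) \<in> borel_measurable M"
  unfolding proj_form_def
  by (intro borel_measurable_sum borel_measurable_times rdot_measurable assms
      measurable_compose[OF X gram_schmidt_measurable]) auto

lemma nondeg_measurable:
  assumes X: "X \<in> measurable M (gauss_frames n k)"
  shows "Measurable.pred M (\<lambda>z. nondeg n k (X z))"
proof -
  have "{z \<in> space M. rdot n (gram_schmidt n (X z) j) (gram_schmidt n (X z) j) = 1} \<in> sets M" if "j < k" for j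
  proof -
    have [measurable]: "(\<lambda>z. rdot n (gram_schmidt n (X z) j) (gram_schmidt n (X z) j)) \<in> borel_measurable M"
      using that by (intro rdot_measurable measurable_compose[OF X gram_schmidt_measurable]) auto
    have "Measurable.pred M (\<lambda>z. rdot n (gram_schmidt n (X z) j) (gram_schmidt n (X z) j) = 1)"
      by (rule pred_eq_const1[where N=borel]) measurable
    then show ?thesis by (simp only: pred_def)
  qed
  then have "{z \<in> space M. \<forall>j\<in>{..<k}. rdot n (gram_schmidt n (X z) j) (gram_schmidt n (X z) j) = 1} \<in> sets M"
    by (intro sets.sets_Collect_finite_All) auto
  then show ?thesis unfolding pred_def nondeg_def by (simp only: Ball_def lessThan_iff)
qed

text \<open>A trace count: the squared residuals of the standard unit vectors sum to
  \<open>n\<close> minus the number of nonzero \<open>u i\<close>, which is positive, so one of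
  these residuals is nonzero.\<close>

lemma orthosystem_complement:
  assumes u: "orthosystem n d u" and "d < n"
  obtains y where "rdot n y y \<noteq> 0" "\<And>i. i < d \<Longrightarrow> rdot n y (u i) = 0"
proof -
  define e where "e = (\<lambda>l l'::nat. if l' = l then 1 else (0::real))"
  have e: "rdot n (e l) x = x l" if "l < n" for l x
  proof -
    have "rdot n (e l) x = (\<Sum>l'<n. if l' = l then x l' else 0)"
      unfolding rdot_def e_def by (intro sum.cong) auto
    then show ?thesis using that by simp
  qed
  have "(\<Sum>l<n. rdot n (residual n d u (e l)) (residual n d u (e l))) = (\<Sum>l<n. 1 - (\<Sum>i<d. (u i l)\<^sup>2))"
    unfolding rdot_residual[OF u] by (intro sum.cong refl) (simp add: e, simp add: e_def)
  also have "\<dots> = real n - (\<Sum>i<d. rdot n (u i) (u i))"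
    by (simp add: sum_subtractf rdot_def power2_eq_square) (rule sum.swap)
  finally have eq: "(\<Sum>l<n. rdot n (residual n d u (e l)) (residual n d u (e l))) =
      real n - (\<Sum>i<d. rdot n (u i) (u i))" .
  have "(\<Sum>i<d. rdot n (u i) (u i)) \<le> (\<Sum>i<d. 1)"
  proof (rule sum_mono)
    fix i assume "i \<in> {..<d}"
    then have "rdot n (u i) (u i) \<in> {0, 1}" using u by (auto simp: orthosystem_def)
    then show "rdot n (u i) (u i) \<le> 1" by auto
  qed
  with eq \<open>d < n\<close> have "(\<Sum>l<n. rdot n (residual n d u (e l)) (residual n d u (e l))) \<noteq> 0" by simp
  then obtain l where "rdot n (residual n d u (e l)) (residual n d u (e l)) \<noteq> 0"
    by (meson sum.neutral)
  with residual_orthogonal[OF u] that show thesis by blast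
qed

text \<open>If the \<open>j\<close>-th Gram--Schmidt vector fails to be a unit vector,
  \<open>X j\<close> is a combination of its predecessors. With the other vectors frozen, this
  confines \<open>X j\<close> to a hyperplane, which is Gaussian null.\<close>

lemma emeasure_degenerate:
  assumes "k \<le> n"
  shows "emeasure (gauss_frames n k) {X \<in> space (gauss_frames n k). \<not> nondeg n k X} = 0"
proof -
  define A where "A = (\<lambda>j. {X \<in> space (gauss_frames n k). rdot n (gram_schmidt n X j) (gram_schmidt n X j) \<noteq> 1})"
  have A: "A j \<in> sets (gauss_frames n k)" if "j < k" for j
  proof -
    have [measurable]: "(\<lambda>X. rdot n (gram_schmidt n X j) (gram_schmidt n X j)) \<in> borel_measurable (gauss_frames n k)"
      using that by (intro rdot_measurable gram_schmidt_measurable) auto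
    show ?thesis unfolding A_def by measurable
  qed
  have null: "emeasure (gauss_frames n k) (A j) = 0" if j: "j < k" for j
  proof -
    define I where "I = {..<k} - {j}"
    have I: "{..<k} = insert j I" "finite I" "j \<notin> I" using j by (auto simp: I_def)
    have "emeasure (gauss_frames n k) (A j) = (\<integral>\<^sup>+X. indicator (A j) X \<partial>gauss_frames n k)"
      using A[OF j] by simp
    also have "\<dots> = (\<integral>\<^sup>+Y. \<integral>\<^sup>+g. indicator (A j) (Y(j := g)) \<partial>gvec n \<partial>PiM I (\<lambda>_. gvec n))"
      unfolding gauss_frames_gvec I(1) using I A[OF j]
      by (intro frames_prod.product_nn_integral_insert) (auto simp: gauss_frames_gvec I(1)[symmetric])
    also have "\<dots> = (\<integral>\<^sup>+Y. 0 \<partial>PiM I (\<lambda>_. gvec n))"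
    proof (rule nn_integral_cong)
      fix Y
      let ?u = "gram_schmidt n Y"
      have u: "orthosystem n j ?u" by (rule gram_schmidt_orthosystem)
      obtain y where y: "rdot n y y \<noteq> 0" "\<And>i. i < j \<Longrightarrow> rdot n y (?u i) = 0"
        using orthosystem_complement[OF u] j assms by auto
      have sub: "rdot n y g = 0" if "Y(j := g) \<in> A j" for g
      proof -
        \<comment> \<open>The Gram--Schmidt vectors of index below \<open>j\<close> do not see the
          replaced entry, so \<open>y\<close> can be chosen before \<open>g\<close>.\<close>
        have "residual n j (gram_schmidt n (Y(j := g))) ((Y(j := g)) j) = residual n j ?u g"
          unfolding residual_def
          using gram_schmidt_cong[of _ "Y(j := g)" Y n] by (intro ext) simp
        then have "rdot n (residual n j ?u g) (residual n j ?u g) = 0"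
          using that unfolding A_def gram_schmidt_eq[of n _ j] by (auto simp: normalize_rdot split: if_splits)
        then have "0 = rdot n (residual n j ?u g) y" by (simp add: rdot_zero_left)
        also have "\<dots> = rdot n g y - (\<Sum>i<j. rdot n g (?u i) * rdot n (?u i) y)"
          by (simp add: residual_def rdot_diff_left rdot_lincomb)
        also have "\<dots> = rdot n y g" using y(2) by (simp add: rdot_commute[of n _ y])
        finally show ?thesis by simp
      qed
      have "(\<integral>\<^sup>+g. indicator (A j) (Y(j := g)) \<partial>gvec n) \<le>
          (\<integral>\<^sup>+g. indicator {g \<in> space (gvec n). rdot n y g = 0} g \<partial>gvec n)"
        using sub by (intro nn_integral_mono) (auto split: split_indicator)
      also have "\<dots> = emeasure (gvec n) {g \<in> space (gvec n). rdot n y g = 0}"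
        by (rule nn_integral_indicator) measurable
      also have "\<dots> = 0" by (rule gvec_hyperplane_null[OF y(1)])
      finally show "(\<integral>\<^sup>+g. indicator (A j) (Y(j := g)) \<partial>gvec n) = 0" by simp
    qed
    finally show ?thesis by simp
  qed
  have "emeasure (gauss_frames n k) {X \<in> space (gauss_frames n k). \<not> nondeg n k X} \<le>
      emeasure (gauss_frames n k) (\<Union>j\<in>{..<k}. A j)"
    using A by (intro emeasure_mono sets.finite_UN) (auto simp: A_def nondeg_def)
  also have "\<dots> \<le> (\<Sum>j<k. emeasure (gauss_frames n k) (A j))"
    using A by (intro emeasure_subadditive_finite) auto
  also have "\<dots> = 0" using null by simp
  finally show ?thesis by simp
qed

text \<open>The inequality is strict so that \<open>x = 0\<close> counts as distorted; hence no null set has to be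
  removed when averaging over a Gaussian \<open>x\<close>.\<close>

definition distorted :: "nat \<Rightarrow> nat \<Rightarrow> real \<Rightarrow> (nat \<Rightarrow> nat \<Rightarrow> real) \<Rightarrow> (nat \<Rightarrow> real) \<Rightarrow> bool" where
  "distorted n k \<eta> u x \<longleftrightarrow> \<not> \<bar>proj_form n k u x x - real k / real n * rdot n x x\<bar> < \<eta> * (real k / real n * rdot n x x)"

text \<open>The squared norm of the projection and that of the whole vector are chi-square with
  \<open>k\<close> and \<open>n\<close> degrees of freedom. Outside four tail events both are close
  to their means, hence so is their ratio to \<open>k / n\<close>.\<close>

lemma distorted_fixed_subspace:
  assumes u: "orthonormal n k u" and k: "0 < k" "k \<le> n" and \<eta>: "0 < \<eta>" "\<eta> \<le> 1"
  shows "emeasure (gvec n) {g \<in> space (gvec n). distorted n k \<eta> u g} \<le> ennreal (4 * exp (- (real k * \<eta>\<^sup>2 / 144)))"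
proof -
  \<comment> \<open>The requirement is 1 + \<theta> \<le> (1 + \<eta>) * (1 - \<theta>); 1 / 3 is
    the largest constant fraction of \<eta> that satisfies it up to \<eta> = 1.\<close>
  define \<theta> where "\<theta> = \<eta> / 3"
  have \<theta>: "0 < \<theta>" "\<theta> \<le> 1" using \<eta> by (auto simp: \<theta>_def)
  define e where "e = (\<lambda>l l'::nat. if l' = l then 1 else (0::real))"
  have e1: "rdot n x (e l) = x l" if "l < n" for l x
  proof -
    have "rdot n x (e l) = (\<Sum>l'<n. if l' = l then x l' else 0)"
      unfolding rdot_def e_def by (intro sum.cong) auto
    then show ?thesis using that by simp
  qed
  \<comment> \<open>For the standard basis \<open>proj_form\<close> is the full squared norm, so the
    same tail bounds serve with \<open>n\<close> degrees of freedom.\<close>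
  have e: "orthonormal n n e" by (auto simp: orthonormal_def e1) (auto simp: e_def)
  have eg: "proj_form n n e g g = rdot n g g" for g
    by (simp add: proj_form_def e1) (simp add: rdot_def)
  define \<tau> where "\<tau> = ennreal (exp (- (real k * \<eta>\<^sup>2 / 144)))"
  define S where "S = (\<lambda>i. {g \<in> space (gvec n).
     [(1 + \<theta>) * k \<le> proj_form n k u g g, proj_form n k u g g \<le> (1 - \<theta>) * k,
      (1 + \<theta>) * n \<le> proj_form n n e g g, proj_form n n e g g \<le> (1 - \<theta>) * n] ! i})"
  have Sm: "S i \<in> sets (gvec n)" if "i < 4" for i
  proof -
    have "i \<in> {0,1,2,3}" using that by auto
    then show ?thesis unfolding S_def by (elim insertE emptyE; simp)
  qed
  have rate: "ennreal (exp (- (real d * \<theta>\<^sup>2 / 16))) \<le> \<tau>" if "k \<le> d" for d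
  proof -
    have "real k * \<eta>\<^sup>2 \<le> real d * \<eta>\<^sup>2" using that by (intro mult_right_mono) auto
    then show ?thesis unfolding \<tau>_def \<theta>_def by (intro ennreal_leI) (simp add: power_divide)
  qed
  have bound: "emeasure (gvec n) (S i) \<le> \<tau>" if "i < 4" for i
  proof -
    have "i \<in> {0,1,2,3}" using that by auto
    then show ?thesis
      using chi_square_upper[OF u less_imp_le[OF \<theta>(1)] \<theta>(2), THEN order_trans, OF rate]
        chi_square_lower[OF u less_imp_le[OF \<theta>(1)] \<theta>(2), THEN order_trans, OF rate]
        chi_square_upper[OF e less_imp_le[OF \<theta>(1)] \<theta>(2), THEN order_trans, OF rate]
        chi_square_lower[OF e less_imp_le[OF \<theta>(1)] \<theta>(2), THEN order_trans, OF rate] k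
      unfolding S_def by (elim insertE emptyE) simp_all
  qed
  have sub: "{g \<in> space (gvec n). distorted n k \<eta> u g} \<subseteq> (\<Union>i<4. S i)"
  proof
    fix g assume g: "g \<in> {g \<in> space (gvec n). distorted n k \<eta> u g}"
    show "g \<in> (\<Union>i<4. S i)"
    proof (rule ccontr)
      assume nS: "g \<notin> (\<Union>i<4. S i)"
      have "g \<notin> S 0" "g \<notin> S 1" "g \<notin> S 2" "g \<notin> S 3" using nS by auto
      then have Y: "proj_form n k u g g < (1 + \<theta>) * k" "(1 - \<theta>) * k < proj_form n k u g g"
        and Z: "rdot n g g < (1 + \<theta>) * n" "(1 - \<theta>) * n < rdot n g g"
        using g by (auto simp: S_def eg)
      define W where "W = real k / real n * rdot n g g"
      have W: "W < (1 + \<theta>) * k" "(1 - \<theta>) * k < W"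
      proof -
        have "real k / real n * (t * n) = t * k" for t using k by simp
        then show "W < (1 + \<theta>) * k" "(1 - \<theta>) * k < W"
          using mult_strict_left_mono[OF Z(1), of "real k / real n"] mult_strict_left_mono[OF Z(2), of "real k / real n"] k
          unfolding W_def by (simp_all add: mult.commute)
      qed
      have "(1 + \<theta>) * k \<le> (1 + \<eta>) * ((1 - \<theta>) * k)"
      proof -
        have "1 + \<theta> \<le> (1 + \<eta>) * (1 - \<theta>)"
          using \<eta> mult_left_mono[of \<eta> 1 \<eta>] by (simp add: \<theta>_def field_simps)
        then show ?thesis using mult_right_mono[of "1 + \<theta>" "(1 + \<eta>) * (1 - \<theta>)" "real k"] by (simp add: mult.assoc)
      qed
      also have "\<dots> < (1 + \<eta>) * W" using W(2) \<eta> by (intro mult_strict_left_mono) auto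
      finally have 1: "proj_form n k u g g < (1 + \<eta>) * W" using Y by simp
      have "(1 - \<eta>) * W \<le> (1 - \<eta>) * ((1 + \<theta>) * k)" using W(1) \<eta> by (intro mult_left_mono) auto
      also have "\<dots> \<le> (1 - \<theta>) * k"
      proof -
        have "(1 - \<eta>) * (1 + \<theta>) \<le> 1 - \<theta>"
          using \<eta> by (simp add: \<theta>_def field_simps)
        then show ?thesis using mult_right_mono[of "(1 - \<eta>) * (1 + \<theta>)" "1 - \<theta>" "real k"] by (simp add: mult.assoc)
      qed
      finally have 2: "(1 - \<eta>) * W < proj_form n k u g g" using Y by simp
      have "\<bar>proj_form n k u g g - W\<bar> < \<eta> * W" using 1 2 by (simp add: abs_less_iff algebra_simps)
      then show False using g by (simp add: distorted_def W_def)
    qed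
  qed
  have "emeasure (gvec n) {g \<in> space (gvec n). distorted n k \<eta> u g} \<le> emeasure (gvec n) (\<Union>i<4. S i)"
    using sub Sm by (intro emeasure_mono) auto
  also have "\<dots> \<le> (\<Sum>i<4. emeasure (gvec n) (S i))"
    using Sm by (intro emeasure_subadditive_finite) auto
  also have "\<dots> \<le> (\<Sum>i<(4::nat). \<tau>)" using bound by (intro sum_mono) auto
  also have "\<dots> = ennreal (4 * exp (- (real k * \<eta>\<^sup>2 / 144)))"
    by (simp add: \<tau>_def ennreal_mult)
  finally show ?thesis .
qed

text \<open>Each rotation in the plane of coordinates 0 and \<open>q\<close> moves the entry at
  \<open>q\<close> into entry 0 and leaves the others alone, so the number of nonzero entries away
  from 0 drops. Scaling finishes on the first axis.\<close>

lemma givens_orbit: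
  fixes P :: "(nat \<Rightarrow> real) \<Rightarrow> 'b"
  assumes rot: "\<And>q c s x. 0 < q \<Longrightarrow> q < n \<Longrightarrow> c\<^sup>2 + s\<^sup>2 = 1 \<Longrightarrow> P (givens 0 q c s x) = P x"
    and scale: "\<And>r x. r \<noteq> 0 \<Longrightarrow> P (\<lambda>l. r * x l) = P x"
    and cong: "\<And>x y. (\<And>l. l < n \<Longrightarrow> x l = y l) \<Longrightarrow> P x = P y"
    and x: "rdot n x x \<noteq> 0"
  shows "P x = P (\<lambda>l. if l = 0 then 1 else 0)"
  using x
proof (induction "card {l. 0 < l \<and> l < n \<and> x l \<noteq> 0}" arbitrary: x rule: less_induct)
  case less
  let ?S = "\<lambda>x::nat \<Rightarrow> real. {l. 0 < l \<and> l < n \<and> x l \<noteq> 0}"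
  have fin: "finite (?S x)" for x by (rule finite_subset[of _ "{..<n}"]) auto
  show ?case
  proof (cases "?S x = {}")
    case True
    then have z: "x l = 0" if "0 < l" "l < n" for l using that by auto
    have "x 0 \<noteq> 0"
    proof
      assume "x 0 = 0"
      then have "\<forall>l<n. x l = 0" using z by (metis gr0I)
      with less.prems show False by (simp add: rdot_self_eq_0)
    qed
    have "P x = P (\<lambda>l. x 0 * (if l = 0 then 1 else 0))"
      by (rule cong) (use z in auto)
    also have "\<dots> = P (\<lambda>l. if l = 0 then 1 else 0)" by (rule scale[OF \<open>x 0 \<noteq> 0\<close>])
    finally show ?thesis .
  next
    case False
    then obtain q where q: "0 < q" "q < n" "x q \<noteq> 0" by auto
    define r where "r = sqrt ((x 0)\<^sup>2 + (x q)\<^sup>2)"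
    have r2: "r\<^sup>2 = (x 0)\<^sup>2 + (x q)\<^sup>2" by (simp add: r_def)
    have r: "r \<noteq> 0" using q(3) by (auto simp: r_def add_nonneg_eq_0_iff)
    \<comment> \<open>Cosine and sine of the angle that sends the pair (\<open>x 0\<close>,
      \<open>x q\<close>) to (\<open>r\<close>, 0).\<close>
    define c s where "c = x 0 / r" and "s = x q / r"
    have cs: "c\<^sup>2 + s\<^sup>2 = 1"
      unfolding c_def s_def power_divide add_divide_distrib[symmetric] r2[symmetric] using r by simp
    define x' where "x' = givens 0 q c s x"
    have x'q: "x' q = 0" by (simp add: x'_def givens_def c_def s_def)
    have x'l: "x' l = x l" if "l \<noteq> 0" "l \<noteq> q" for l using that by (simp add: x'_def givens_def)
    have "?S x' \<subseteq> ?S x - {q}"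
    proof
      fix l assume l: "l \<in> ?S x'"
      then have "l \<noteq> q" using x'q by auto
      with l show "l \<in> ?S x - {q}" using x'l[of l] by auto
    qed
    then have "?S x' \<subset> ?S x" using q by blast
    then have "card (?S x') < card (?S x)" by (rule psubset_card_mono[OF fin])
    moreover have "rdot n x' x' \<noteq> 0"
      unfolding x'_def using rdot_givens[of 0 n q c s] q cs less.prems by simp
    ultimately have "P x' = P (\<lambda>l. if l = 0 then 1 else 0)" by (rule less.hyps)
    then show ?thesis unfolding x'_def using rot[OF q(1,2) cs] by simp
  qed
qed

text \<open>The probability \<open>P\<close> is constant on nonzero vectors, so \<open>P x\<close>
  is at most its Gaussian average. After Fubini the frame is fixed and
  \<open>distorted_fixed_subspace\<close> bounds the inner integral.\<close>

lemma distorted_prob: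
  assumes k: "0 < k" "k \<le> n" and \<eta>: "0 < \<eta>" "\<eta> \<le> 1" and x: "rdot n x x \<noteq> 0"
  shows "emeasure (gauss_frames n k)
      {X \<in> space (gauss_frames n k). distorted n k \<eta> (gram_schmidt n X) x} \<le> ennreal (4 * exp (- (real k * \<eta>\<^sup>2 / 144)))"
proof -
  interpret PP: pair_prob_space "gauss_frames n k" "gvec n" ..
  let ?F = "gauss_frames n k"
  define B where "B = (\<lambda>X x. distorted n k \<eta> (gram_schmidt n X) x)"
  define P where "P = (\<lambda>x. emeasure ?F {X \<in> space ?F. B X x})"
  have Bm: "Measurable.pred M (\<lambda>z. B (X z) (y z))"
    if "\<And>l. l < n \<Longrightarrow> (\<lambda>z. y z l) \<in> borel_measurable M" "X \<in> measurable M ?F" for y X and M :: "'z measure"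
  proof -
    have [measurable]: "(\<lambda>z. proj_form n k (gram_schmidt n (X z)) (y z) (y z)) \<in> borel_measurable M"
      "(\<lambda>z. rdot n (y z) (y z)) \<in> borel_measurable M"
      using that by (auto intro!: proj_form_frames_measurable rdot_measurable)
    show ?thesis unfolding B_def distorted_def by measurable
  qed
  have Bset: "{X \<in> space ?F. B X y} \<in> sets ?F" for y
    using Bm[of "\<lambda>_. y" ?F "\<lambda>X. X"] by (simp add: pred_def)
  have P_const: "P y = P (\<lambda>l. if l = 0 then 1 else 0)" if "rdot n y y \<noteq> 0" for y
  proof (rule givens_orbit[OF _ _ _ that])
    fix q c s x assume q: "0 < q" "q < n" and cs: "c\<^sup>2 + s\<^sup>2 = (1::real)"
    let ?T = "givens 0 q c s"
    have 0: "0 < n" "0 \<noteq> q" using q by auto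
    have cm: "compose {..<k} ?T \<in> measurable ?F ?F"
      unfolding gauss_frames_gvec compose_def
      using givens_measurable[OF 0(1) q(2) 0(2) cs] by measurable
    \<comment> \<open>Rotating the vector is undone by rotating the frame, whose law is
      invariant.\<close>
    have "P (?T x) = emeasure (distr ?F ?F (compose {..<k} ?T)) {X \<in> space ?F. B X (?T x)}"
      unfolding P_def gauss_frames_givens[OF 0(1) q(2) 0(2) cs] ..
    also have "\<dots> = emeasure ?F (compose {..<k} ?T -` {X \<in> space ?F. B X (?T x)} \<inter> space ?F)"
      by (rule emeasure_distr[OF cm Bset])
    also have "compose {..<k} ?T -` {X \<in> space ?F. B X (?T x)} \<inter> space ?F = {X \<in> space ?F. B X x}"
    proof -
      have "B (compose {..<k} ?T X) (?T x) = B X x" for X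
      proof -
        have "gram_schmidt n (compose {..<k} ?T X) j = ?T (gram_schmidt n X j)" if "j < k" for j
          by (rule gram_schmidt_givens[OF 0(1) q(2) 0(2) cs _ that]) (simp add: compose_def)
        then show ?thesis
          unfolding B_def distorted_def proj_form_def by (simp add: rdot_givens[OF 0(1) q(2) 0(2) cs])
      qed
      then show ?thesis using measurable_space[OF cm] by auto
    qed
    finally show "P (?T x) = P x" by (simp add: P_def)
  next
    fix r :: real and x assume "r \<noteq> 0"
    have "B X (\<lambda>l. r * x l) = B X x" for X
    proof -
      have 1: "proj_form n k (gram_schmidt n X) (\<lambda>l. r * x l) (\<lambda>l. r * x l) = r\<^sup>2 * proj_form n k (gram_schmidt n X) x x"
        by (simp add: proj_form_def rdot_scale_left sum_distrib_left power2_eq_square algebra_simps)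
      have 2: "rdot n (\<lambda>l. r * x l) (\<lambda>l. r * x l) = r\<^sup>2 * rdot n x x"
        by (simp add: rdot_def sum_distrib_left power2_eq_square algebra_simps)
      have "\<bar>r\<^sup>2 * a - k' * (r\<^sup>2 * b)\<bar> < \<eta> * (k' * (r\<^sup>2 * b)) \<longleftrightarrow> \<bar>a - k' * b\<bar> < \<eta> * (k' * b)" for a b k' :: real
      proof -
        have "r\<^sup>2 * a - k' * (r\<^sup>2 * b) = r\<^sup>2 * (a - k' * b)" by (simp add: algebra_simps)
        then have "\<bar>r\<^sup>2 * a - k' * (r\<^sup>2 * b)\<bar> = r\<^sup>2 * \<bar>a - k' * b\<bar>" by (simp add: abs_mult)
        moreover have "\<eta> * (k' * (r\<^sup>2 * b)) = r\<^sup>2 * (\<eta> * (k' * b))" by (simp add: algebra_simps)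
        ultimately show ?thesis using \<open>r \<noteq> 0\<close> by simp
      qed
      then show ?thesis unfolding B_def distorted_def 1 2 by (simp only:)
    qed
    then show "P (\<lambda>l. r * x l) = P x" by (simp add: P_def)
  next
    fix x y :: "nat \<Rightarrow> real" assume "\<And>l. l < n \<Longrightarrow> x l = y l"
    then have "rdot n x z = rdot n y z" "rdot n z x = rdot n z y" for z by (auto intro: rdot_cong)
    then show "P x = P y" by (simp add: P_def B_def distorted_def proj_form_def)
  qed
  have P_le: "P x \<le> P y" for y
  proof (cases "rdot n y y = 0")
    case True
    then have "B X y" for X by (simp add: B_def distorted_def)
    then have "P y = 1" by (simp add: P_def gauss_frames.emeasure_space_1)
    then show ?thesis by (simp add: P_def gauss_frames.emeasure_le_1)
  next
    case False
    then show ?thesis using P_const[OF x] P_const[of y] by simp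
  qed
  have pair_meas: "(\<lambda>(X, g). indicator {z. B (fst z) (snd z)} (X, g) :: ennreal) \<in> borel_measurable (?F \<Otimes>\<^sub>M gvec n)"
  proof -
    have "Measurable.pred (?F \<Otimes>\<^sub>M gvec n) (\<lambda>z. B (fst z) (snd z))"
      by (intro Bm measurable_fst measurable_compose[OF measurable_snd gvec_coord])
    then show ?thesis by (simp add: case_prod_beta indicator_def) 
  qed
  have "P x = (\<integral>\<^sup>+g. P x \<partial>gvec n)" by (simp add: gvec.emeasure_space_1)
  also have "\<dots> \<le> (\<integral>\<^sup>+g. P g \<partial>gvec n)" by (intro nn_integral_mono P_le)
  also have "\<dots> = (\<integral>\<^sup>+g. \<integral>\<^sup>+X. indicator {z. B (fst z) (snd z)} (X, g) \<partial>?F \<partial>gvec n)"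
  proof (rule nn_integral_cong)
    fix g
    have "P g = (\<integral>\<^sup>+X. indicator {X \<in> space ?F. B X g} X \<partial>?F)"
      unfolding P_def using Bset[of g] by simp
    also have "\<dots> = (\<integral>\<^sup>+X. indicator {z. B (fst z) (snd z)} (X, g) \<partial>?F)"
      by (intro nn_integral_cong) (auto split: split_indicator)
    finally show "P g = (\<integral>\<^sup>+X. indicator {z. B (fst z) (snd z)} (X, g) \<partial>?F)" .
  qed
  also have "\<dots> = (\<integral>\<^sup>+X. \<integral>\<^sup>+g. indicator {z. B (fst z) (snd z)} (X, g) \<partial>gvec n \<partial>?F)"
    by (rule PP.Fubini'[OF pair_meas])
  \<comment> \<open>The tail bound needs an orthonormal system. For degenerate frames the inner
    integral is bounded by 1, and these frames form a null set.\<close>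
  also have "\<dots> \<le> (\<integral>\<^sup>+X. indicator {X \<in> space ?F. \<not> nondeg n k X} X + ennreal (4 * exp (- (real k * \<eta>\<^sup>2 / 144))) \<partial>?F)"
  proof (rule nn_integral_mono)
    fix X assume X: "X \<in> space ?F"
    show "(\<integral>\<^sup>+g. indicator {z. B (fst z) (snd z)} (X, g) \<partial>gvec n) \<le>
      indicator {X \<in> space ?F. \<not> nondeg n k X} X + ennreal (4 * exp (- (real k * \<eta>\<^sup>2 / 144)))"
    proof (cases "nondeg n k X")
      case True
      have "{g \<in> space (gvec n). B X g} \<in> sets (gvec n)"
        using Bm[of "\<lambda>g. g" "gvec n" "\<lambda>_. X"] X gvec_coord by (simp add: pred_def)
      then have "emeasure (gvec n) {g \<in> space (gvec n). B X g} = (\<integral>\<^sup>+g. indicator {g \<in> space (gvec n). B X g} g \<partial>gvec n)"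
        by simp
      also have "\<dots> = (\<integral>\<^sup>+g. indicator {z. B (fst z) (snd z)} (X, g) \<partial>gvec n)"
        by (intro nn_integral_cong) (auto split: split_indicator)
      finally show ?thesis
        using distorted_fixed_subspace[OF nondeg_orthonormal[OF True] k \<eta>] True by (simp add: B_def)
    next
      case False
      have "(\<integral>\<^sup>+g. indicator {z. B (fst z) (snd z)} (X, g) \<partial>gvec n) \<le> (\<integral>\<^sup>+g. 1 \<partial>gvec n)"
        by (intro nn_integral_mono) (auto split: split_indicator)
      then show ?thesis using False X by (simp add: gvec.emeasure_space_1 add_increasing2)
    qed
  qed
  also have "\<dots> = emeasure ?F {X \<in> space ?F. \<not> nondeg n k X} + ennreal (4 * exp (- (real k * \<eta>\<^sup>2 / 144)))"
  proof -
    have "{X \<in> space ?F. \<not> nondeg n k X} \<in> sets ?F"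
      using nondeg_measurable[of "\<lambda>X. X" ?F n k] by (simp add: pred_def sets.sets_Collect_neg)
    then show ?thesis by (subst nn_integral_add) (auto simp: gauss_frames.emeasure_space_1)
  qed
  also have "\<dots> = ennreal (4 * exp (- (real k * \<eta>\<^sup>2 / 144)))" by (simp add: emeasure_degenerate[OF k(2)])
  finally show ?thesis by (simp add: P_def B_def)
qed

section \<open>Focused pairs\<close>

lemma perm_list_measurable:
  assumes "\<And>i j. (\<lambda>z. c z i j) \<in> borel_measurable M"
  shows "(\<lambda>z. perm_list (c z) is J) \<in> borel_measurable M"
  by (induction "is" arbitrary: J) (auto intro!: borel_measurable_sum borel_measurable_times assms)

lemma perm_form_measurable:
  assumes "\<And>i j. (\<lambda>z. c z i j) \<in> borel_measurable M"
  shows "(\<lambda>z. perm_form N m \<alpha> \<beta> (c z)) \<in> borel_measurable M"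
  unfolding perm_form_def
  by (intro borel_measurable_sum borel_measurable_times perm_list_measurable assms borel_measurable_const)

section \<open>Polarization\<close>

lemma proj_form_combine:
  "proj_form n k u (\<lambda>l. x l + t * y l) (\<lambda>l. x l + t * y l) =
    proj_form n k u x x + 2 * t * proj_form n k u x y + t\<^sup>2 * proj_form n k u y y"
  by (simp add: proj_form_def rdot_add_left rdot_scale_left sum.distrib sum_distrib_left
      power2_eq_square algebra_simps)

lemma rdot_combine:
  "rdot n (\<lambda>l. x l + t * y l) (\<lambda>l. x l + t * y l) = rdot n x x + 2 * t * rdot n x y + t\<^sup>2 * rdot n y y"
  by (simp add: rdot_def sum.distrib sum_distrib_left power2_eq_square algebra_simps)

text \<open>Four times a scalar product is the difference of the squared norms of
  \<open>A + B\<close> and \<open>A - B\<close>. By the parallelogram law these norms sum to 4, so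
  the errors add up to at most 4 * \<epsilon> * \<delta> * \<kappa>, and \<delta> \<le>
  \<open>rdot n A B\<close> makes the error relative.\<close>

lemma polarized_estimate:
  assumes A: "rdot n A A = 1" and B: "rdot n B B = 1" and \<kappa>: "\<kappa> \<ge> 0" and \<delta>: "\<delta> \<le> rdot n A B" and \<epsilon>: "0 \<le> \<epsilon>"
    and h: "\<And>t. t \<in> {1, -1} \<Longrightarrow>
      \<bar>proj_form n k u (\<lambda>l. A l + t * B l) (\<lambda>l. A l + t * B l) - \<kappa> * rdot n (\<lambda>l. A l + t * B l) (\<lambda>l. A l + t * B l)\<bar>
        \<le> \<epsilon> * \<delta> * (\<kappa> * rdot n (\<lambda>l. A l + t * B l) (\<lambda>l. A l + t * B l))"
  shows "\<bar>proj_form n k u A B - \<kappa> * rdot n A B\<bar> \<le> \<epsilon> * (\<kappa> * rdot n A B)"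
proof -
  let ?q = "proj_form n k u A B" and ?r = "rdot n A B"
  \<comment> \<open>The errors of the two squared norms of \<open>A\<close> and \<open>B\<close>;
    they enter both estimates with the same sign and cancel in the difference.\<close>
  let ?s = "proj_form n k u A A + proj_form n k u B B - 2 * \<kappa>"
  have "\<bar>?s + 2 * (?q - \<kappa> * ?r)\<bar> \<le> \<epsilon> * \<delta> * (\<kappa> * (2 + 2 * ?r))"
    using h[of 1] unfolding proj_form_combine rdot_combine A B by (simp add: algebra_simps)
  moreover have "\<bar>?s - 2 * (?q - \<kappa> * ?r)\<bar> \<le> \<epsilon> * \<delta> * (\<kappa> * (2 - 2 * ?r))"
    using h[of "-1"] unfolding proj_form_combine rdot_combine A B by (simp add: algebra_simps)
  moreover have "\<epsilon> * \<delta> * (\<kappa> * (2 + 2 * ?r)) + \<epsilon> * \<delta> * (\<kappa> * (2 - 2 * ?r)) = 4 * (\<epsilon> * (\<kappa> * \<delta>))"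
    by (simp add: algebra_simps)
  moreover have "\<bar>d\<bar> \<le> z" if "\<bar>s + 2 * d\<bar> \<le> x" "\<bar>s - 2 * d\<bar> \<le> y" "x + y = 4 * z" for d s x y z :: real
    using that by linarith
  ultimately have "\<bar>?q - \<kappa> * ?r\<bar> \<le> \<epsilon> * (\<kappa> * \<delta>)" by blast
  also have "\<dots> \<le> \<epsilon> * (\<kappa> * ?r)" using \<kappa> \<delta> \<epsilon> by (intro mult_left_mono) auto
  finally show ?thesis .
qed

lemma polarized_estimate_scaled:
  assumes a: "rdot n a a \<noteq> 0" and b: "rdot n b b \<noteq> 0" and \<kappa>: "\<kappa> \<ge> 0" and \<epsilon>: "0 \<le> \<epsilon>"
    and \<delta>: "\<delta> * rnorm n a * rnorm n b \<le> rdot n a b"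
    and h: "\<And>t v. t \<in> {1, -1} \<Longrightarrow> v = (\<lambda>l. a l / rnorm n a + t * (b l / rnorm n b)) \<Longrightarrow>
      \<bar>proj_form n k u v v - \<kappa> * rdot n v v\<bar> \<le> \<epsilon> * \<delta> * (\<kappa> * rdot n v v)"
  shows "\<bar>proj_form n k u a b - \<kappa> * rdot n a b\<bar> \<le> \<epsilon> * (\<kappa> * rdot n a b)"
proof -
  define r where "r = rnorm n a * rnorm n b"
  have pos: "rnorm n a > 0" "rnorm n b > 0"
    using a b rdot_self_nonneg[of n a] rdot_self_nonneg[of n b] by (auto simp: rnorm_def less_le)
  then have r: "r > 0" by (simp add: r_def)
  have 1: "rdot n (\<lambda>l. a l / rnorm n a) (\<lambda>l. b l / rnorm n b) = rdot n a b / r"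
    by (simp add: rdot_divide_left rdot_commute[of n a "\<lambda>l. b l / _"] rdot_commute[of n b a] r_def)
  have 2: "proj_form n k u (\<lambda>l. a l / rnorm n a) (\<lambda>l. b l / rnorm n b) = proj_form n k u a b / r"
    by (simp add: proj_form_def rdot_divide_left sum_divide_distrib r_def)
  have "\<bar>proj_form n k u a b / r - \<kappa> * (rdot n a b / r)\<bar> \<le> \<epsilon> * (\<kappa> * (rdot n a b / r))"
    unfolding 1[symmetric] 2[symmetric]
  proof (rule polarized_estimate[OF _ _ \<kappa> _ \<epsilon> h[OF _ refl]])
    show "\<delta> \<le> rdot n (\<lambda>l. a l / rnorm n a) (\<lambda>l. b l / rnorm n b)"
      unfolding 1 using \<delta> r by (simp add: r_def field_simps)
  qed (use a b in \<open>simp_all add: normalize_rdot\<close>)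
  then have "r * \<bar>proj_form n k u a b / r - \<kappa> * (rdot n a b / r)\<bar> \<le> r * (\<epsilon> * (\<kappa> * (rdot n a b / r)))"
    using r by (intro mult_left_mono) auto
  moreover have "r * \<bar>proj_form n k u a b / r - \<kappa> * (rdot n a b / r)\<bar> = \<bar>r * (proj_form n k u a b / r - \<kappa> * (rdot n a b / r))\<bar>"
    using r by (simp add: abs_mult)
  moreover have "r * (proj_form n k u a b / r - \<kappa> * (rdot n a b / r)) = proj_form n k u a b - \<kappa> * rdot n a b"
    using r by (simp add: field_simps)
  ultimately show ?thesis using r by simp
qed

text \<open>The lower entry bound gives the second inequality directly. For the first, (1 -
  \<epsilon>) * (1 + \<epsilon>) \<le> 1 turns the upper entry bound into one with the factor 1 -
  \<epsilon>.\<close>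

lemma perm_form_sandwich:
  assumes focused: "\<forall>I\<in>msubsets N m. \<alpha> I \<ge> 0" "\<forall>J\<in>msubsets N m. \<beta> J \<ge> 0"
    and \<epsilon>: "0 < \<epsilon>" "\<epsilon> < 1" and \<kappa>: "\<kappa> \<ge> 0"
    and c: "\<And>i j. i < N \<Longrightarrow> j < N \<Longrightarrow> 0 \<le> c i j"
    and d: "\<And>i j. i < N \<Longrightarrow> j < N \<Longrightarrow> \<bar>d i j - \<kappa> * c i j\<bar> \<le> \<epsilon> * (\<kappa> * c i j)"
  shows "(1 - \<epsilon>) ^ m * perm_form N m \<alpha> \<beta> d \<le> \<kappa> ^ m * perm_form N m \<alpha> \<beta> c"
    and "\<kappa> ^ m * perm_form N m \<alpha> \<beta> c \<le> perm_form N m \<alpha> \<beta> d / (1 - \<epsilon>) ^ m"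
proof -
  have w: "0 \<le> \<kappa> * c i j" "(1 - \<epsilon>) * (\<kappa> * c i j) \<le> d i j" "d i j \<le> (1 + \<epsilon>) * (\<kappa> * c i j)"
    if "i < N" "j < N" for i j
    using c[OF that] d[OF that] \<kappa> by (auto simp: abs_le_iff algebra_simps)
  have low: "0 \<le> (1 - \<epsilon>) * d i j \<and> (1 - \<epsilon>) * d i j \<le> \<kappa> * c i j" if "i < N" "j < N" for i j
  proof -
    have "0 \<le> (1 - \<epsilon>) * (\<kappa> * c i j)" using w(1)[OF that] \<epsilon> by simp
    then have "0 \<le> d i j" using w(2)[OF that] by simp
    moreover have "(1 - \<epsilon>) * d i j \<le> (1 - \<epsilon>) * ((1 + \<epsilon>) * (\<kappa> * c i j))"
      using w(3)[OF that] \<epsilon> by (intro mult_left_mono) auto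
    moreover have "\<dots> = (1 - \<epsilon>\<^sup>2) * (\<kappa> * c i j)" by (simp add: power2_eq_square algebra_simps)
    moreover have "\<dots> \<le> 1 * (\<kappa> * c i j)" using w(1)[OF that] by (intro mult_right_mono) auto
    ultimately show ?thesis using \<epsilon> by simp
  qed
  show "(1 - \<epsilon>) ^ m * perm_form N m \<alpha> \<beta> d \<le> \<kappa> ^ m * perm_form N m \<alpha> \<beta> c"
    unfolding perm_form_scale[symmetric] by (rule perm_form_mono[OF low focused])
  have "\<kappa> ^ m * perm_form N m \<alpha> \<beta> c \<le> (1 / (1 - \<epsilon>)) ^ m * perm_form N m \<alpha> \<beta> d"
    unfolding perm_form_scale[symmetric]
  proof (rule perm_form_mono[OF _ focused])
    fix i j assume "i < N" "j < N"
    from w[OF this] \<epsilon> show "0 \<le> \<kappa> * c i j \<and> \<kappa> * c i j \<le> 1 / (1 - \<epsilon>) * d i j"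
      by (simp add: field_simps)
  qed
  then show "\<kappa> ^ m * perm_form N m \<alpha> \<beta> c \<le> perm_form N m \<alpha> \<beta> d / (1 - \<epsilon>) ^ m"
    by (simp add: power_divide)
qed

text \<open>Since 864 / 144 = 6, each exponential is at most M^(-6) with M = N + 2. The count 8 *
  N^2 consumes two powers, and M \<ge> 3 leaves 8 / 81.\<close>

lemma union_bound_numeric:
  fixes N :: nat and x :: real
  assumes "0 < N" "864 * ln (real N + 2) \<le> x"
  shows "real (2 * N * N) * (4 * exp (- (x / 144))) \<le> 1 / 3"
proof -
  define M where "M = real N + 2"
  have M: "M \<ge> 3" "real N \<le> M" using assms by (auto simp: M_def)
  have "exp (- (x / 144)) \<le> exp (- (6 * ln M))" using assms by (simp add: M_def)
  also have "\<dots> = 1 / M ^ 6"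
  proof -
    have "exp (6 * ln M) = exp (ln M) ^ 6" using exp_of_nat_mult[of 6 "ln M"] by simp
    then show ?thesis using M by (simp add: exp_minus inverse_eq_divide)
  qed
  finally have e: "exp (- (x / 144)) \<le> 1 / M ^ 6" .
  have "real (2 * N * N) * (4 * exp (- (x / 144))) = 8 * (real N * real N) * exp (- (x / 144))" by simp
  also have "\<dots> \<le> 8 * (M * M) * (1 / M ^ 6)"
    using e M by (intro mult_mono) auto
  also have "\<dots> = 8 / M ^ 4" using M by (simp add: divide_simps power_numeral_reduce)
  also have "\<dots> \<le> 8 / 3 ^ 4" using M by (intro divide_left_mono power_mono) auto
  also have "\<dots> \<le> 1 / 3" by simp
  finally show ?thesis .
qed

text \<open>Zero vectors are exempted because a difference of two normalised vectors vanishes when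
  they are parallel, and 0 always counts as distorted.\<close>

lemma simultaneous_embedding_prob:
  fixes v :: "'t \<Rightarrow> nat \<Rightarrow> real"
  assumes k: "0 < k" "k \<le> n" and \<eta>: "0 < \<eta>" "\<eta> \<le> 1" and T: "finite T"
  defines "G \<equiv> {X \<in> space (gauss_frames n k). nondeg n k X \<and>
      (\<forall>t\<in>T. rdot n (v t) (v t) \<noteq> 0 \<longrightarrow> \<not> distorted n k \<eta> (gram_schmidt n X) (v t))}"
  shows "G \<in> sets (gauss_frames n k)"
    and "measure (gauss_frames n k) G \<ge> 1 - real (card T) * (4 * exp (- (real k * \<eta>\<^sup>2 / 144)))"
proof -
  let ?F = "gauss_frames n k"
  let ?e = "4 * exp (- (real k * \<eta>\<^sup>2 / 144))"
  define T' where "T' = {t \<in> T. rdot n (v t) (v t) \<noteq> 0}"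
  define S where "S = (\<lambda>t. {X \<in> space ?F. distorted n k \<eta> (gram_schmidt n X) (v t)})"
  define D where "D = {X \<in> space ?F. \<not> nondeg n k X}"
  have Dm: "D \<in> sets ?F"
    using nondeg_measurable[of "\<lambda>X. X" ?F n k] by (simp add: D_def pred_def sets.sets_Collect_neg)
  have Sm: "S t \<in> sets ?F" for t
  proof -
    have [measurable]: "(\<lambda>X. proj_form n k (gram_schmidt n X) (v t) (v t)) \<in> borel_measurable ?F"
      by (intro proj_form_frames_measurable) auto
    show ?thesis unfolding S_def distorted_def by measurable
  qed
  have G_eq: "G = space ?F - (D \<union> (\<Union>t\<in>T'. S t))" by (auto simp: G_def D_def S_def T'_def)
  have Um: "D \<union> (\<Union>t\<in>T'. S t) \<in> sets ?F" using Dm Sm T by (intro sets.Un sets.finite_UN) (auto simp: T'_def)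
  show "G \<in> sets ?F" unfolding G_eq using Um by auto
  have D0: "measure ?F D = 0" using emeasure_degenerate[OF k(2)] by (simp add: measure_def D_def)
  have St: "measure ?F (S t) \<le> ?e" if "t \<in> T'" for t
    using distorted_prob[OF k \<eta>, of "v t"] that
    by (simp add: S_def T'_def gauss_frames.emeasure_eq_measure)
  have "measure ?F (D \<union> (\<Union>t\<in>T'. S t)) \<le> measure ?F D + measure ?F (\<Union>t\<in>T'. S t)"
    using Dm Sm T by (intro measure_Un_le sets.finite_UN) (auto simp: T'_def)
  also have "measure ?F (\<Union>t\<in>T'. S t) \<le> (\<Sum>t\<in>T'. measure ?F (S t))"
    using Sm T by (intro gauss_frames.finite_measure_subadditive_finite) (auto simp: T'_def)
  also have "\<dots> \<le> (\<Sum>t\<in>T'. ?e)" by (intro sum_mono St)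
  also have "\<dots> = real (card T') * ?e" by simp
  also have "\<dots> \<le> real (card T) * ?e"
    using T by (intro mult_right_mono of_nat_mono card_mono) (auto simp: T'_def)
  finally have "measure ?F (D \<union> (\<Union>t\<in>T'. S t)) \<le> real (card T) * ?e" using D0 by simp
  then show "measure ?F G \<ge> 1 - real (card T) * ?e"
    unfolding G_eq gauss_frames.prob_compl[OF Um] by simp
qed

lemma focused_restriction_prob:
  assumes f: "focused n N m \<delta> a b \<alpha> \<beta>" and \<delta>: "0 < \<delta>" "\<delta> \<le> 1" and N: "0 < N"
    and \<epsilon>: "0 < \<epsilon>" "\<epsilon> < 1" and k: "0 < k" "k \<le> n"
    and rate: "864 * ln (real N + 2) \<le> real k * (\<epsilon> * \<delta>)\<^sup>2"
  shows "grass_prob n k (\<lambda>L.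
        let F = cpoly n N m a \<alpha>; G = cpoly n N m b \<beta>;
            IL = Re (sub_gip n k L F G); I = Re (gip n F G)
        in (1 - \<epsilon>) ^ m * IL \<le> (real k / real n) ^ m * I \<and>
           (real k / real n) ^ m * I \<le> IL / (1 - \<epsilon>) ^ m) \<ge> 2 / 3"
proof -
  let ?F = "gauss_frames n k"
  define \<kappa> where "\<kappa> = real k / real n"
  define \<eta> where "\<eta> = \<epsilon> * \<delta>"
  have \<eta>: "0 < \<eta>" "\<eta> \<le> 1" using \<epsilon> \<delta> by (auto simp: \<eta>_def intro: mult_le_one)
  define I where "I = perm_form N m \<alpha> \<beta> (\<lambda>i j. rdot n (a i) (b j))"
  define IL where "IL = (\<lambda>X. Re (sub_gip n k (lspan n k X) (cpoly n N m a \<alpha>) (cpoly n N m b \<beta>)))"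
  define C where "C = (\<lambda>y. (1 - \<epsilon>) ^ m * y \<le> \<kappa> ^ m * I \<and> \<kappa> ^ m * I \<le> y / (1 - \<epsilon>) ^ m)"
  define E where "E = {X \<in> space ?F. C (IL X)}"
  \<comment> \<open>Comparing the measures of \<open>G\<close> and \<open>E\<close> requires
    \<open>E\<close> to be measurable. Although \<open>sub_gip\<close> chooses a basis, its value on
    nondegenerate frames is a measurable expression in the Gram--Schmidt vectors, and it is constant
    on the others.\<close>
  have ILm: "IL \<in> borel_measurable ?F"
  proof -
    have "IL = (\<lambda>X. if nondeg n k X
        then perm_form N m \<alpha> \<beta> (\<lambda>i j. proj_form n k (gram_schmidt n X) (a i) (b j))
        else Re (gip k (\<lambda>w. cpoly n N m a \<alpha> (cemb k (SOME u. False) w))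
          (\<lambda>w. cpoly n N m b \<beta> (cemb k (SOME u. False) w))))"
      unfolding IL_def using sub_gip_onb[OF nondeg_is_onb] sub_gip_degenerate by (intro ext) simp
    moreover have "(\<lambda>X. if nondeg n k X
        then perm_form N m \<alpha> \<beta> (\<lambda>i j. proj_form n k (gram_schmidt n X) (a i) (b j))
        else Re (gip k (\<lambda>w. cpoly n N m a \<alpha> (cemb k (SOME u. False) w))
          (\<lambda>w. cpoly n N m b \<beta> (cemb k (SOME u. False) w)))) \<in> borel_measurable ?F"
      by (intro measurable_If perm_form_measurable proj_form_frames_measurable borel_measurable_const
          measurable_ident nondeg_measurable[unfolded pred_def]) auto
    ultimately show ?thesis by simp
  qed
  have Em: "E \<in> sets ?F" unfolding E_def C_def using ILm by measurable
  define T where "T = {..<N} \<times> {..<N} \<times> {1::real, -1}"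
  define v where "v = (\<lambda>(i, j, t) l. a i l / rnorm n (a i) + t * (b j l / rnorm n (b j)))"
  define G where "G = {X \<in> space ?F. nondeg n k X \<and>
      (\<forall>t\<in>T. rdot n (v t) (v t) \<noteq> 0 \<longrightarrow> \<not> distorted n k \<eta> (gram_schmidt n X) (v t))}"
  have T: "finite T" "card T = 2 * N * N" by (auto simp: T_def)
  have "G \<subseteq> E"
  proof
    fix X assume X: "X \<in> G"
    let ?u = "gram_schmidt n X"
    have nd: "nondeg n k X" using X by (simp add: G_def)
    have est: "\<bar>proj_form n k ?u (a i) (b j) - \<kappa> * rdot n (a i) (b j)\<bar> \<le> \<epsilon> * (\<kappa> * rdot n (a i) (b j))"
      if ij: "i < N" "j < N" for i j
    proof (rule polarized_estimate_scaled)
      show "rdot n (a i) (a i) \<noteq> 0" "rdot n (b j) (b j) \<noteq> 0"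
        using f ij by (auto simp: focused_def rdot_self_eq_0)
      show "\<delta> * rnorm n (a i) * rnorm n (b j) \<le> rdot n (a i) (b j)" using f ij by (auto simp: focused_def)
      fix t :: real and w assume t: "t \<in> {1, -1}" and w: "w = (\<lambda>l. a i l / rnorm n (a i) + t * (b j l / rnorm n (b j)))"
      have w': "w = v (i, j, t)" by (simp add: w v_def)
      show "\<bar>proj_form n k ?u w w - \<kappa> * rdot n w w\<bar> \<le> \<epsilon> * \<delta> * (\<kappa> * rdot n w w)"
      proof (cases "rdot n w w = 0")
        \<comment> \<open>For vanishing \<open>w\<close> the event \<open>G\<close> gives no
          information, but both sides of the estimate are 0.\<close>
        case True
        then show ?thesis by (simp add: proj_form_def rdot_zero_left)
      next
        case False
        moreover have "(i, j, t) \<in> T" using ij t by (simp add: T_def)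
        ultimately have "\<not> distorted n k \<eta> ?u w" using X by (auto simp: G_def w')
        then show ?thesis by (simp add: distorted_def \<kappa>_def \<eta>_def)
      qed
    qed (use \<epsilon> in \<open>auto simp: \<kappa>_def\<close>)
    have nn: "0 \<le> rdot n (a i) (b j)" if "i < N" "j < N" for i j
    proof -
      have "0 \<le> \<delta> * rnorm n (a i) * rnorm n (b j)" using \<delta> by (simp add: rnorm_def)
      also have "\<dots> \<le> rdot n (a i) (b j)" using f that by (auto simp: focused_def)
      finally show ?thesis .
    qed
    have "IL X = perm_form N m \<alpha> \<beta> (\<lambda>i j. proj_form n k ?u (a i) (b j))"
      by (simp add: IL_def sub_gip_onb[OF nondeg_is_onb[OF nd]])
    moreover have "\<forall>I\<in>msubsets N m. \<alpha> I \<ge> 0" "\<forall>J\<in>msubsets N m. \<beta> J \<ge> 0" "\<kappa> \<ge> 0"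
      using f by (auto simp: focused_def \<kappa>_def)
    ultimately have "C (IL X)"
      using perm_form_sandwich[of N m \<alpha> \<beta> \<epsilon> \<kappa> "\<lambda>i j. rdot n (a i) (b j)"
          "\<lambda>i j. proj_form n k ?u (a i) (b j)"] \<epsilon> nn est
      unfolding C_def I_def by simp
    then show "X \<in> E" using X by (simp add: E_def G_def)
  qed
  then have "measure ?F G \<le> measure ?F E"
    using Em by (intro gauss_frames.finite_measure_mono)
  moreover have "measure ?F G \<ge> 1 - real (card T) * (4 * exp (- (real k * \<eta>\<^sup>2 / 144)))"
    unfolding G_def by (rule simultaneous_embedding_prob(2)[OF k \<eta> T(1)])
  moreover have "real (card T) * (4 * exp (- (real k * \<eta>\<^sup>2 / 144))) \<le> 1 / 3"
    unfolding T(2) by (rule union_bound_numeric[OF N]) (use rate in \<open>simp add: \<eta>_def\<close>)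
  ultimately have "2 / 3 \<le> measure ?F E" by linarith
  then show ?thesis
    unfolding grass_prob_def E_def C_def IL_def I_def \<kappa>_def by (simp add: gip_cpoly Let_def)
qed

theorem theorem4p3:
  "\<exists>\<gamma>::real. \<gamma> > 0 \<and>
    (\<forall>(\<delta>::real) (N::nat) (n::nat) (m::nat) (a::nat \<Rightarrow> nat \<Rightarrow> real) (b::nat \<Rightarrow> nat \<Rightarrow> real)
       (\<alpha>::nat set \<Rightarrow> real) (\<beta>::nat set \<Rightarrow> real) (\<epsilon>::real) (k::nat).
      0 < \<delta> \<and> \<delta> \<le> 1 \<and> 0 < N \<and> focused n N m \<delta> a b \<alpha> \<beta> \<and>
      0 < \<epsilon> \<and> \<epsilon> < 1 \<and> 0 < k \<and> k \<le> n \<and>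
      real k \<ge> \<gamma> * \<epsilon> powi (-2) * \<delta> powi (-2) * ln (real N + 2)
      \<longrightarrow>
      grass_prob n k (\<lambda>L.
        let F = cpoly n N m a \<alpha>; G = cpoly n N m b \<beta>;
            IL = Re (sub_gip n k L F G); I = Re (gip n F G)
        in (1 - \<epsilon>) ^ m * IL \<le> (real k / real n) ^ m * I \<and>
           (real k / real n) ^ m * I \<le> IL / (1 - \<epsilon>) ^ m) \<ge> 2 / 3)"
proof (intro exI[of _ 864] conjI allI impI)
  fix \<delta> \<epsilon> :: real and N n m k :: nat and a b :: "nat \<Rightarrow> nat \<Rightarrow> real" and \<alpha> \<beta> :: "nat set \<Rightarrow> real"
  assume *: "0 < \<delta> \<and> \<delta> \<le> 1 \<and> 0 < N \<and> focused n N m \<delta> a b \<alpha> \<beta> \<and>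
      0 < \<epsilon> \<and> \<epsilon> < 1 \<and> 0 < k \<and> k \<le> n \<and>
      real k \<ge> 864 * \<epsilon> powi (-2) * \<delta> powi (-2) * ln (real N + 2)"
  then have "864 * \<epsilon> powi (-2) * \<delta> powi (-2) * ln (real N + 2) * (\<epsilon> * \<delta>)\<^sup>2 \<le> real k * (\<epsilon> * \<delta>)\<^sup>2"
    by (intro mult_right_mono) auto
  then have "864 * ln (real N + 2) \<le> real k * (\<epsilon> * \<delta>)\<^sup>2"
    using * by (simp add: power_int_minus field_simps power_mult_distrib)
  then show "grass_prob n k (\<lambda>L.
        let F = cpoly n N m a \<alpha>; G = cpoly n N m b \<beta>;
            IL = Re (sub_gip n k L F G); I = Re (gip n F G)
        in (1 - \<epsilon>) ^ m * IL \<le> (real k / real n) ^ m * I \<and>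
           (real k / real n) ^ m * I \<le> IL / (1 - \<epsilon>) ^ m) \<ge> 2 / 3"
    using * by (intro focused_restriction_prob) auto
qed simp

end
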